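(* Assume $\diamondsuit(\mathfrak b)$ and $\mathfrak d=\omega_1$. Then for every $n\geq 1$ there exists a Hausdorff topological space of size $\omega_1$ which is $n$-sequentially compact but not $(n+1)$-sequentially compact.
   Context: $[B]^n$ denotes the set of all subsets of $B$ of cardinality $n$ and $[B]^\omega$ the set of all countably infinite subsets of $B$. For a topological space $X$, a countable set $B$, $n\ge 1$, a function $f:[B]^n\to X$ and $p\in X$, $f$ converges to $p$ if for every neighborhood $U$ of $p$ there is a finite $F\subseteq B$ with $f''[B\setminus F]^n\subseteq U$ (where $f''S=\{f(x):x\in S\}$); $f$ is convergent if it converges to some $p\in X$. The space $X$ is $n$-sequentially compact if for every $f:[\omega]^n\to X$ there is $B\in[\omega]^\omega$ such that $f\restriction[B]^n$ is convergent. For $f,g\in\omega^\omega$, $f\le^* g$ means that $\{k:f(k)>g(k)\}$ is finite, and $f\not\ge^* g$ means that $g\le^* f$ fails. $\mathfrak d$ is the minimum size of a dominating family, i.e. a family $\mathcal D\subseteq\omega^\omega$ such that every $f\in\omega^\omega$ satisfies $f\le^* d$ for some $d\in\mathcal D$. A function $F:2^{<\omega_1}\to\omega^\omega$ is Borel if its restriction to $2^\delta$ is a Borel map for every $\delta<\omega_1$. The principle $\diamondsuit(\mathfrak b)$ states: for every Borel $F:2^{<\omega_1}\to\omega^\omega$ there is $g:\omega_1\to\omega^\omega$ such that for every $f\in 2^{\omega_1}$ the set $\{\alpha\in\omega_1: F(f\restriction\alpha)\not\ge^* g(\alpha)\}$ is stationary in $\omega_1$. *)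

theory Defs
  imports "HOL-Analysis.Analysis" "HOL-Library.Ramsey"
begin

unbundle cardinal_syntax

section \<open>The ordinal \<open>\<omega>\<^sub>1\<close>\<close>

text \<open>The points of \<open>omega1\<close> are the ordinals below \<open>\<omega>\<^sub>1\<close>; an ordinal \<open>\<delta> < \<omega>\<^sub>1\<close>, regarded as the
  set of its predecessors, is \<open>{..<\<delta>}\<close>.\<close>

typedef omega1 = "Field (cardSuc natLeq)"
proof -
  have "infinite (Field (cardSuc natLeq))"
    using cardSuc_finite[OF natLeq_Card_order] Field_natLeq by simp
  then show ?thesis using infinite_imp_nonempty by blast
qed

instantiation omega1 :: ord
begin

definition less_eq_omega1 :: "omega1 \<Rightarrow> omega1 \<Rightarrow> bool" where
  "x \<le> y \<longleftrightarrow> (Rep_omega1 x, Rep_omega1 y) \<in> cardSuc natLeq"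

definition less_omega1 :: "omega1 \<Rightarrow> omega1 \<Rightarrow> bool" where
  "(x :: omega1) < y \<longleftrightarrow> x \<le> y \<and> x \<noteq> y"

instance ..

end

instance omega1 :: wellorder
proof -
  have W: "Well_order (cardSuc natLeq)"
    using cardSuc_Card_order[OF natLeq_Card_order] card_order_on_well_order_on by blast
  interpret R: wo_rel "cardSuc natLeq" using W by (simp add: wo_rel_def)
  have refl: "x \<le> x" for x :: omega1
    using R.REFL Rep_omega1 by (auto simp: less_eq_omega1_def refl_on_def)
  have trans: "x \<le> z" if "x \<le> y" "y \<le> z" for x y z :: omega1
    using R.TRANS that unfolding less_eq_omega1_def by (meson transD)
  have anti: "x = y" if "x \<le> y" "y \<le> x" for x y :: omega1
    using R.ANTISYM that unfolding less_eq_omega1_def by (meson Rep_omega1_inject antisymD)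
  have tot: "x \<le> y \<or> y \<le> x" for x y :: omega1
    using R.TOTALS Rep_omega1 unfolding less_eq_omega1_def by blast
  have wf: "wf {(x, y :: omega1). x < y}"
  proof (rule wf_subset[OF wf_inv_image[OF R.WF, of Rep_omega1]])
    show "{(x, y :: omega1). x < y} \<subseteq> inv_image (cardSuc natLeq - Id) Rep_omega1"
      by (auto simp: less_omega1_def less_eq_omega1_def Rep_omega1_inject)
  qed
  show "OFCLASS(omega1, wellorder_class)"
  proof
    fix x y z :: omega1
    show "x < y \<longleftrightarrow> x \<le> y \<and> \<not> y \<le> x"
      using refl anti unfolding less_omega1_def by metis
    show "x \<le> x" by (rule refl)
    show "x \<le> y \<Longrightarrow> y \<le> z \<Longrightarrow> x \<le> z" by (rule trans)
    show "x \<le> y \<Longrightarrow> y \<le> x \<Longrightarrow> x = y" by (rule anti)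
    show "x \<le> y \<or> y \<le> x" by (rule tot)
  next
    fix P :: "omega1 \<Rightarrow> bool" and a
    assume "\<And>x. (\<And>y. y < x \<Longrightarrow> P y) \<Longrightarrow> P x"
    then show "P a" using wf_induct_rule[OF wf, of P a] by auto
  qed
qed

lemma card_of_omega1: "|UNIV :: omega1 set| =o cardSuc natLeq"
proof -
  have "bij_betw Rep_omega1 UNIV (Field (cardSuc natLeq))"
    by (metis bij_betw_def inj_def Rep_omega1_inject type_definition.Rep_range type_definition_omega1)
  then have "|UNIV :: omega1 set| =o |Field (cardSuc natLeq)|"
    using card_of_ordIso by blast
  then show ?thesis
    using card_of_Field_ordIso[OF cardSuc_Card_order[OF natLeq_Card_order]] ordIso_transitive
    by blast
qed

lemma uncountable_omega1: "uncountable (UNIV :: omega1 set)"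
proof
  assume "countable (UNIV :: omega1 set)"
  then have "|UNIV :: omega1 set| \<le>o |UNIV :: nat set|"
    by (auto simp: countable_def card_of_ordLeq[symmetric])
  then have "cardSuc natLeq \<le>o natLeq"
    using card_of_omega1 card_of_nat ordIso_symmetric ordIso_ordLeq_trans ordLeq_ordIso_trans by blast
  then show False
    using cardSuc_greater[OF natLeq_Card_order] not_ordLess_ordLeq by blast
qed

lemma countable_lessThan_omega1: "countable {..<\<delta> :: omega1}"
proof -
  let ?r = "cardSuc natLeq"
  have sub: "Rep_omega1 ` {..<\<delta>} \<subseteq> underS ?r (Rep_omega1 \<delta>)"
    by (auto simp: underS_def less_omega1_def less_eq_omega1_def Rep_omega1_inject)
  have "|underS ?r (Rep_omega1 \<delta>)| <o ?r"
    using card_of_underS[OF cardSuc_Card_order[OF natLeq_Card_order] Rep_omega1] .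
  then have "|underS ?r (Rep_omega1 \<delta>)| \<le>o natLeq"
    using cardSuc_ordLess_ordLeq card_of_Card_order natLeq_Card_order
      cardSuc_ordLeq_ordLess by blast
  then have "|underS ?r (Rep_omega1 \<delta>)| \<le>o |UNIV :: nat set|"
    using card_of_nat ordIso_symmetric ordLeq_ordIso_trans by blast
  then have "countable (underS ?r (Rep_omega1 \<delta>))"
    by (auto simp: countable_def card_of_ordLeq[symmetric])
  then have "countable (Rep_omega1 ` {..<\<delta>})"
    using sub countable_subset by blast
  then show ?thesis
    by (rule countable_image_inj_on) (auto simp: inj_on_def Rep_omega1_inject)
qed

definition closed_unbounded :: "omega1 set \<Rightarrow> bool" where
  "closed_unbounded C \<longleftrightarrow>
     (\<forall>\<alpha>. \<exists>\<beta>\<in>C. \<alpha> < \<beta>) \<and>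
     (\<forall>\<alpha>. {..<\<alpha>} \<noteq> {} \<and> (\<forall>\<beta><\<alpha>. \<exists>\<gamma>\<in>C. \<beta> < \<gamma> \<and> \<gamma> < \<alpha>) \<longrightarrow> \<alpha> \<in> C)"

definition stationary :: "omega1 set \<Rightarrow> bool" where
  "stationary S \<longleftrightarrow> (\<forall>C. closed_unbounded C \<longrightarrow> S \<inter> C \<noteq> {})"


section \<open>The dominating number\<close>

definition le_star :: "(nat \<Rightarrow> nat) \<Rightarrow> (nat \<Rightarrow> nat) \<Rightarrow> bool"  (infix \<open>\<le>\<^sup>*\<close> 50) where
  "f \<le>\<^sup>* g \<longleftrightarrow> finite {k. f k > g k}"

definition dominating :: "(nat \<Rightarrow> nat) set \<Rightarrow> bool" where
  "dominating D \<longleftrightarrow> (\<forall>f. \<exists>d\<in>D. f \<le>\<^sup>* d)"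

text \<open>Cardinals are represented by cardinal orders, up to \<open>=o\<close>.\<close>

definition dominating_number :: "(nat \<Rightarrow> nat) rel" where
  "dominating_number =
     |SOME D. dominating D \<and> (\<forall>E. dominating E \<longrightarrow> |D| \<le>o |E| )|"

lemma ex_minimal_dominating:
  "\<exists>D. dominating D \<and> (\<forall>E. dominating E \<longrightarrow> |D| \<le>o |E| )"
proof -
  have "dominating UNIV"
    unfolding dominating_def le_star_def by (metis (no_types, lifting) Collect_empty_eq UNIV_I finite.emptyI less_irrefl)
  then have "card_of ` Collect dominating \<noteq> {}" by blast
  moreover have "\<forall>r \<in> card_of ` Collect dominating. Well_order r"
    using card_of_Well_order by blast
  ultimately obtain r where "r \<in> card_of ` Collect dominating"
    and "\<forall>r' \<in> card_of ` Collect dominating. r \<le>o r'"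
    using exists_minim_Well_order by meson
  then show ?thesis by blast
qed


section \<open>The principle \<open>\<diamondsuit>(\<bb>)\<close>\<close>

definition borel_of :: "'a topology \<Rightarrow> 'a measure" where
  "borel_of X = sigma (topspace X) {U. openin X U}"

text \<open>The space \<open>2\<^sup>\<delta>\<close>; its points are the functions on \<open>{..<\<delta>}\<close>, extended by
  \<open>undefined\<close>.\<close>

definition two_pow :: "omega1 \<Rightarrow> (omega1 \<Rightarrow> bool) topology" where
  "two_pow \<delta> = product_topology (\<lambda>_. discrete_topology UNIV) {..<\<delta>}"

text \<open>The set \<open>2\<^bsup><\<omega>\<^sub>1\<^esup>\<close> is the disjoint union of the \<open>2\<^sup>\<delta>\<close>. As an extensional function does
  not determine its domain, a map \<open>F\<close> on \<open>2\<^bsup><\<omega>\<^sub>1\<^esup>\<close> is a family of maps \<open>F \<delta>\<close>, one on each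
  \<open>2\<^sup>\<delta>\<close>.\<close>

definition borel_levels :: "(omega1 \<Rightarrow> (omega1 \<Rightarrow> bool) \<Rightarrow> (nat \<Rightarrow> nat)) \<Rightarrow> bool" where
  "borel_levels F \<longleftrightarrow> (\<forall>\<delta>. F \<delta> \<in> borel_measurable (borel_of (two_pow \<delta>)))"

definition diamond_b :: bool where
  "diamond_b \<longleftrightarrow>
     (\<forall>F. borel_levels F \<longrightarrow>
       (\<exists>g :: omega1 \<Rightarrow> nat \<Rightarrow> nat. \<forall>f :: omega1 \<Rightarrow> bool.
          stationary {\<alpha>. \<not> g \<alpha> \<le>\<^sup>* F \<alpha> (restrict f {..<\<alpha>})}))"


section \<open>Convergence of functions on \<open>n\<close>-element sets\<close>

definition nset_converges ::
  "'a topology \<Rightarrow> nat \<Rightarrow> 'b set \<Rightarrow> ('b set \<Rightarrow> 'a) \<Rightarrow> 'a \<Rightarrow> bool" where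
  "nset_converges X n B f p \<longleftrightarrow>
     p \<in> topspace X \<and>
     (\<forall>U. openin X U \<and> p \<in> U \<longrightarrow> (\<exists>F. finite F \<and> F \<subseteq> B \<and> f ` nsets (B - F) n \<subseteq> U))"

definition n_sequentially_compact :: "nat \<Rightarrow> 'a topology \<Rightarrow> bool" where
  "n_sequentially_compact n X \<longleftrightarrow>
     (\<forall>f \<in> nsets (UNIV :: nat set) n \<rightarrow> topspace X.
        \<exists>B :: nat set. infinite B \<and> (\<exists>p. nset_converges X n B f p))"

end

(* The space is the one-point compactification of the Mrowka-Isbell space of an almost disjoint family
   on the countable set of increasing (n+1)-tuples. The family consists of the sets of tuples with
   first entry c and of sets A_d, d < omega_1. A tuple y belongs to A_d if, for some j \<le> y_0, it
   grows faster than the first j members (in some enumeration) of a dominating family restricted to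
   the indices below d, and y_n \<le> g_d(j), where g is obtained from the diamond principle.

   The principle makes every [D]^(n+1) meet cofinally many A_d outside every finite set, so the
   identity on (n+1)-sets has no convergent restriction. For a function f on n-sets, n parameters
   cannot produce n+1 values each of which outgrows the previous one: after passing to an infinite
   set, some h satisfies f(x)_(i+1) \<le> h(f(x)_i) for some i < n, for all x. If the b-th dominating
   function dominates h, then A_d contains only finitely many such tuples for d > b, and the
   countably many remaining members of the family are treated by a diagonal Ramsey argument. *)

theory Submission
  imports Defs
begin

section \<open>Properties of almost all n-element subsets of a set of naturals\<close>

lemma nsets_insert_Min:
  fixes C :: "nat set"
  assumes "x \<in> nsets C (Suc n)"
  obtains a y where "a \<in> C" "y \<in> nsets (C \<inter> {a<..}) n" "x = insert a y"
proof -
  have x: "x \<subseteq> C" "finite x" "card x = Suc n" "x \<noteq> {}"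
    using assms by (auto simp: nsets_def)
  have "Min x \<in> x" using x by simp
  moreover have "x - {Min x} \<in> nsets (C \<inter> {Min x<..}) n"
    using x \<open>Min x \<in> x\<close> by (auto simp: nsets_def less_le)
  moreover have "x = insert (Min x) (x - {Min x})" using \<open>Min x \<in> x\<close> by blast
  ultimately show thesis using that x by blast
qed

lemma in_nsets_mono: "x \<in> nsets A n \<Longrightarrow> A \<subseteq> B \<Longrightarrow> x \<in> nsets B n"
  by (auto simp: nsets_def)

text \<open>The exceptional finite set in the definition of convergence is taken to be an initial
  segment of the naturals, so that two of them combine by \<open>max\<close>;
  \<open>almost_all_nsets_iff_finite\<close> shows that the two forms agree.\<close>

definition almost_all_nsets :: "nat \<Rightarrow> nat set \<Rightarrow> (nat set \<Rightarrow> bool) \<Rightarrow> bool" where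
  "almost_all_nsets n C P \<longleftrightarrow> (\<exists>m. \<forall>x\<in>nsets (C \<inter> {m<..}) n. P x)"

lemma almost_all_nsetsI: "(\<And>x. x \<in> nsets C n \<Longrightarrow> P x) \<Longrightarrow> almost_all_nsets n C P"
  unfolding almost_all_nsets_def by (meson inf_le1 in_nsets_mono)

lemma almost_all_nsets_mono:
  assumes "almost_all_nsets n C P" "C' \<subseteq> C" "\<And>x. x \<in> nsets C' n \<Longrightarrow> P x \<Longrightarrow> Q x"
  shows "almost_all_nsets n C' Q"
proof -
  obtain m where "\<forall>x\<in>nsets (C \<inter> {m<..}) n. P x"
    using assms(1) by (auto simp: almost_all_nsets_def)
  then have "Q x" if "x \<in> nsets (C' \<inter> {m<..}) n" for x
    using that assms(2,3) in_nsets_mono[OF that, of "C \<inter> {m<..}"] in_nsets_mono[OF that, of C']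
    by blast
  then show ?thesis by (auto simp: almost_all_nsets_def)
qed

lemma almost_all_nsets_conj:
  assumes "almost_all_nsets n C P" "almost_all_nsets n C Q"
  shows "almost_all_nsets n C (\<lambda>x. P x \<and> Q x)"
proof -
  obtain m k where mk: "\<forall>x\<in>nsets (C \<inter> {m<..}) n. P x" "\<forall>x\<in>nsets (C \<inter> {k<..}) n. Q x"
    using assms by (auto simp: almost_all_nsets_def)
  have "P x \<and> Q x" if "x \<in> nsets (C \<inter> {max m k<..}) n" for x
  proof -
    have "C \<inter> {max m k<..} \<subseteq> C \<inter> {m<..}" "C \<inter> {max m k<..} \<subseteq> C \<inter> {k<..}" by auto
    then show ?thesis using mk in_nsets_mono[OF that] by blast
  qed
  then show ?thesis by (auto simp: almost_all_nsets_def)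
qed

lemma almost_all_nsets_Ball:
  assumes "finite T" "\<And>t. t \<in> T \<Longrightarrow> almost_all_nsets n C (P t)"
  shows "almost_all_nsets n C (\<lambda>x. \<forall>t\<in>T. P t x)"
  using assms
  by (induction T) (auto intro: almost_all_nsetsI almost_all_nsets_conj)

lemma almost_all_nsets_iff_finite:
  "almost_all_nsets n C P \<longleftrightarrow> (\<exists>F. finite F \<and> F \<subseteq> C \<and> (\<forall>x\<in>nsets (C - F) n. P x))"
proof
  assume "almost_all_nsets n C P"
  then obtain m where "\<forall>x\<in>nsets (C \<inter> {m<..}) n. P x" by (auto simp: almost_all_nsets_def)
  moreover have "C - (C \<inter> {..m}) = C \<inter> {m<..}" by auto
  ultimately show "\<exists>F. finite F \<and> F \<subseteq> C \<and> (\<forall>x\<in>nsets (C - F) n. P x)"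
    by (metis finite_Int finite_atMost inf_le1)
next
  assume "\<exists>F. finite F \<and> F \<subseteq> C \<and> (\<forall>x\<in>nsets (C - F) n. P x)"
  then obtain F where F: "finite F" "\<forall>x\<in>nsets (C - F) n. P x" by blast
  then obtain m where "F \<subseteq> {..m}" by (auto simp: finite_nat_iff_bounded_le)
  then have "C \<inter> {m<..} \<subseteq> C - F" by force
  then show "almost_all_nsets n C P"
    using F in_nsets_mono unfolding almost_all_nsets_def by blast
qed

lemma nset_converges_iff:
  "nset_converges X n B f p \<longleftrightarrow>
     p \<in> topspace X \<and> (\<forall>U. openin X U \<and> p \<in> U \<longrightarrow> almost_all_nsets n B (\<lambda>x. f x \<in> U))"
  unfolding nset_converges_def almost_all_nsets_iff_finite image_subset_iff by simp

section \<open>Ramsey and diagonal arguments on n-element subsets\<close>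

lemma Ramsey_dichotomy:
  assumes "infinite B"
  shows "\<exists>C\<subseteq>B. infinite C \<and> ((\<forall>x\<in>nsets C n. P x) \<or> (\<forall>x\<in>nsets C n. \<not> P x))"
proof -
  define f where "f x = (if P x then 0 else 1 :: nat)" for x
  have "\<forall>X. X \<subseteq> B \<and> finite X \<and> card X = n \<longrightarrow> f X < 2" by (simp add: f_def)
  from Ramsey[OF assms this] obtain C t where
    C: "C \<subseteq> B" "infinite C" "\<forall>X. X \<subseteq> C \<and> finite X \<and> card X = n \<longrightarrow> f X = t" by blast
  have "(\<forall>x\<in>nsets C n. P x) \<or> (\<forall>x\<in>nsets C n. \<not> P x)"
    using C(3) by (cases "t = 0") (auto simp: f_def nsets_def split: if_splits)
  then show ?thesis using C by blast
qed

text \<open>A fusion argument: in a decreasing sequence of infinite sets, each set lies beyond the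
  minimum of its predecessor and is good for that minimum. The minima form \<open>C\<close>, and
  those after the \<open>m\<close>-th all lie in the set chosen for it.\<close>

lemma diagonal_intersection:
  fixes B :: "nat set"
  assumes B: "infinite B"
    and step: "\<And>a A. infinite A \<Longrightarrow> A \<subseteq> B \<Longrightarrow> \<exists>A'\<subseteq>A. infinite A' \<and> Q a A'"
    and hereditary: "\<And>a A A'. Q a A \<Longrightarrow> A' \<subseteq> A \<Longrightarrow> Q a A'"
  shows "\<exists>C\<subseteq>B. infinite C \<and> (\<forall>a\<in>C. Q a (C \<inter> {a<..}))"
proof -
  have "\<exists>A. \<forall>m. (infinite (A m) \<and> A m \<subseteq> B) \<and>
          (A (Suc m) \<subseteq> A m \<inter> {Inf (A m)<..} \<and> Q (Inf (A m)) (A (Suc m)))"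
  proof (rule dependent_nat_choice)
    show "\<exists>A. infinite A \<and> A \<subseteq> B" using B by blast
  next
    fix A :: "nat set" and m :: nat
    assume A: "infinite A \<and> A \<subseteq> B"
    have "A - (A \<inter> {Inf A<..}) \<subseteq> {..Inf A}" by auto
    then have "infinite (A \<inter> {Inf A<..})"
      using A by (metis Diff_infinite_finite finite_atMost finite_subset)
    then show "\<exists>A'. (infinite A' \<and> A' \<subseteq> B) \<and> A' \<subseteq> A \<inter> {Inf A<..} \<and> Q (Inf A) A'"
      using step[of "A \<inter> {Inf A<..}" "Inf A"] A by blast
  qed
  then obtain A where inf: "infinite (A m)" and sub: "A m \<subseteq> B"
    and Suc: "A (Suc m) \<subseteq> A m \<inter> {Inf (A m)<..}" and Q: "Q (Inf (A m)) (A (Suc m))" for m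
    by blast
  define c where "c m = Inf (A m)" for m
  have c_in: "c m \<in> A m" for m
    unfolding c_def using inf[of m] by (intro Inf_nat_def1) auto
  have anti: "A k \<subseteq> A m" if "m \<le> k" for m k
    by (rule lift_Suc_antimono_le[OF _ that]) (use Suc in blast)
  have mono: "strict_mono c"
    using c_in Suc unfolding strict_mono_Suc_iff c_def by blast
  have "Q (c m) (range c \<inter> {c m<..})" for m
  proof (rule hereditary)
    show "Q (c m) (A (Suc m))" using Q by (simp add: c_def)
    show "range c \<inter> {c m<..} \<subseteq> A (Suc m)"
    proof
      fix b assume "b \<in> range c \<inter> {c m<..}"
      then obtain k where "b = c k" "Suc m \<le> k"
        using strict_mono_less[OF mono] by (auto simp: less_eq_Suc_le[symmetric])
      then show "b \<in> A (Suc m)" using c_in anti by blast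
    qed
  qed
  then show ?thesis
    using c_in sub range_inj_infinite[OF strict_mono_imp_inj_on[OF mono]]
    by (intro exI[of _ "range c"] conjI) auto
qed

text \<open>If no \<open>P k\<close> holds throughout an infinite subset of \<open>B\<close>,
  Ramsey's theorem allows any finite number of the \<open>P k\<close> to be avoided by thinning. A
  diagonal intersection avoids \<open>P 0, ..., P a\<close> beyond each of its elements
  \<open>a\<close>, and so each \<open>P k\<close> beyond any element above
  \<open>k\<close>.\<close>

lemma homogeneous_or_avoiding:
  assumes B: "infinite B"
  shows "\<exists>C\<subseteq>B. infinite C \<and>
    ((\<exists>k::nat. \<forall>x\<in>nsets C n. P k x) \<or> (\<forall>k. almost_all_nsets n C (\<lambda>x. \<not> P k x)))"
proof (cases "\<exists>C\<subseteq>B. infinite C \<and> (\<exists>k. \<forall>x\<in>nsets C n. P k x)")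
  case False
  have thin: "\<exists>A'\<subseteq>A. infinite A' \<and> (\<forall>x\<in>nsets A' n. \<not> P k x)"
    if "infinite A" "A \<subseteq> B" for A k
    using Ramsey_dichotomy[OF that(1), of n "P k"] False that(2) by blast
  define Q where "Q a A \<longleftrightarrow> (\<forall>k\<le>a. \<forall>x\<in>nsets A n. \<not> P k x)" for a A
  have "\<exists>A'\<subseteq>A. infinite A' \<and> Q a A'" if A: "infinite A" "A \<subseteq> B" for a A
  proof (induction a)
    case 0
    then show ?case using thin[OF A, of 0] unfolding Q_def by auto
  next
    case (Suc a)
    then obtain A' where A': "A' \<subseteq> A" "infinite A'" "Q a A'" by blast
    obtain A'' where A'': "A'' \<subseteq> A'" "infinite A''" "\<forall>x\<in>nsets A'' n. \<not> P (Suc a) x"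
      using thin[of A' "Suc a", OF A'(2) subset_trans[OF A'(1) A(2)]] by blast
    have "\<not> P k x" if "k \<le> Suc a" "x \<in> nsets A'' n" for k x
      using that A'(3) A''(3) in_nsets_mono[OF that(2) A''(1)] unfolding Q_def le_Suc_eq by blast
    then show ?case using A'(1) A''(1,2) unfolding Q_def by (intro exI[of _ A'']) simp
  qed
  moreover have "Q a A'" if "Q a A" "A' \<subseteq> A" for a A A'
    using that(1) in_nsets_mono[OF _ that(2)] unfolding Q_def by blast
  ultimately obtain C where C: "C \<subseteq> B" "infinite C" "\<forall>a\<in>C. Q a (C \<inter> {a<..})"
    using diagonal_intersection[of B Q, OF B] by metis
  have "almost_all_nsets n C (\<lambda>x. \<not> P k x)" for k
  proof -
    obtain a where "a \<in> C" "k < a" using C(2) infinite_nat_iff_unbounded by blast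
    then show ?thesis using C(3) unfolding almost_all_nsets_def Q_def
      by (meson less_imp_le)
  qed
  then show ?thesis using C by blast
qed blast

text \<open>By induction on \<open>n\<close>, with \<open>a = Min x\<close> fixed. If \<open>Y 1\<close> is constant on an infinite set, the
  constant bounds it; otherwise \<open>Y 1\<close> tends to infinity on an infinite set and the induction
  hypothesis applies to \<open>Y 1, \<dots>, Y (n + 1)\<close>. A diagonal intersection makes the bounds for different
  \<open>a\<close> hold on one set, and as \<open>Y 0\<close> tends to infinity, only finitely many \<open>a\<close> matter for each
  argument of \<open>h\<close>.\<close>

lemma growth_bounded:
  fixes Y :: "nat \<Rightarrow> nat set \<Rightarrow> nat"
  assumes "infinite B"
    and "\<And>i x. i < n \<Longrightarrow> Y i x \<le> Y (Suc i) x"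
    and "\<And>k. almost_all_nsets n B (\<lambda>x. k < Y 0 x)"
  shows "\<exists>C\<subseteq>B. infinite C \<and> (\<exists>h. \<forall>x\<in>nsets C n. \<exists>i<n. Y (Suc i) x \<le> h (Y i x))"
  using assms
proof (induction n arbitrary: B Y)
  case 0
  \<comment> \<open>The only 0-element set is \<open>{}\<close>, so the hypothesis on
    \<open>Y 0\<close> is contradictory at \<open>k = Y 0 {}\<close>.\<close>
  from 0(3)[of "Y 0 {}"] show ?case by (auto simp: almost_all_nsets_def nsets_def)
next
  case (Suc n)
  define Q where "Q a A \<longleftrightarrow> (\<exists>h. \<forall>x\<in>nsets A n.
      \<exists>i<Suc n. Y (Suc i) (insert a x) \<le> h (Y i (insert a x)))" for a A
  have "\<exists>A'\<subseteq>A. infinite A' \<and> Q a A'" if A: "infinite A" for a A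
  proof -
    obtain A' where A': "A' \<subseteq> A" "infinite A'" and dich: "(\<exists>k. \<forall>x\<in>nsets A' n. Y 1 (insert a x) = k) \<or>
        (\<forall>k. almost_all_nsets n A' (\<lambda>x. Y 1 (insert a x) \<noteq> k))"
      using homogeneous_or_avoiding[of A n "\<lambda>k x. Y 1 (insert a x) = k", OF A] by blast
    from dich show ?thesis
    proof
      assume "\<exists>k. \<forall>x\<in>nsets A' n. Y 1 (insert a x) = k"
      then obtain k where "\<forall>x\<in>nsets A' n. Y 1 (insert a x) = k" by blast
      then have "Q a A'"
        unfolding Q_def by (intro exI[of _ "\<lambda>_. k"]) auto
      then show ?thesis using A' by blast
    next
      assume av: "\<forall>k. almost_all_nsets n A' (\<lambda>x. Y 1 (insert a x) \<noteq> k)"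
      have "almost_all_nsets n A' (\<lambda>x. k < Y (Suc 0) (insert a x))" for k
      proof (rule almost_all_nsets_mono)
        show "almost_all_nsets n A' (\<lambda>x. \<forall>j\<in>{..k}. Y 1 (insert a x) \<noteq> j)"
          using av by (intro almost_all_nsets_Ball) auto
      qed (auto simp: not_less[symmetric])
      then obtain A'' h where "A'' \<subseteq> A'" "infinite A''" and
        "\<forall>x\<in>nsets A'' n. \<exists>i<n. Y (Suc (Suc i)) (insert a x) \<le> h (Y (Suc i) (insert a x))"
        using Suc.IH[OF A'(2), of "\<lambda>i x. Y (Suc i) (insert a x)"] Suc.prems(2) by auto
      moreover from this have "Q a A''"
        unfolding Q_def by (meson Suc_mono)
      ultimately show ?thesis using A' by (meson subset_trans)
    qed
  qed
  moreover have "Q a A'" if "Q a A" "A' \<subseteq> A" for a A A'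
    using that(1) in_nsets_mono[OF _ that(2)] unfolding Q_def by meson
  ultimately obtain C where C: "C \<subseteq> B" "infinite C" "\<forall>a\<in>C. Q a (C \<inter> {a<..})"
    using diagonal_intersection[of B Q, OF Suc.prems(1)] by metis
  then obtain h where h: "\<And>a x. a \<in> C \<Longrightarrow> x \<in> nsets (C \<inter> {a<..}) n \<Longrightarrow>
      \<exists>i<Suc n. Y (Suc i) (insert a x) \<le> h a (Y i (insert a x))"
    unfolding Q_def by metis
  from Suc.prems(3) obtain r where
    r: "\<And>k x. x \<in> nsets (B \<inter> {r k<..}) (Suc n) \<Longrightarrow> k < Y 0 x"
    unfolding almost_all_nsets_def by metis
  note mono = Suc.prems(2)
  have "\<exists>i<Suc n. Y (Suc i) x \<le> (\<Sum>a\<le>r (Y i x). h a (Y i x))"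
    if x: "x \<in> nsets C (Suc n)" for x
  proof -
    obtain a y where a: "a \<in> C" "y \<in> nsets (C \<inter> {a<..}) n" "x = insert a y"
      using nsets_insert_Min[OF x] by blast
    then obtain i where i: "i < Suc n" "Y (Suc i) x \<le> h a (Y i x)" using h by blast
    have "Y 0 x \<le> Y i x" using i(1)
    proof (induction i)
      case (Suc j)
      then show ?case using mono[of j x] by simp
    qed simp
    \<comment> \<open>Otherwise all of \<open>x\<close> lies beyond \<open>r (Y i x)\<close>, which
      forces \<open>Y i x < Y 0 x\<close>.\<close>
    have "a \<le> r (Y i x)"
    proof (rule ccontr)
      assume "\<not> a \<le> r (Y i x)"
      then have "x \<in> nsets (B \<inter> {r (Y i x)<..}) (Suc n)"
        using a x C(1) by (fastforce simp: nsets_def)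
      then show False using r \<open>Y 0 x \<le> Y i x\<close> by fastforce
    qed
    then have "h a (Y i x) \<le> (\<Sum>a\<le>r (Y i x). h a (Y i x))"
      by (intro member_le_sum) auto
    then show ?thesis using i by (meson le_trans)
  qed
  then show ?case using C
    by (intro exI[of _ C] conjI exI[of _ "\<lambda>k. \<Sum>a\<le>r k. h a k"]) auto
qed

section \<open>The compactified Mrowka-Isbell space\<close>

text \<open>The point of the member \<open>S b\<close> of the family is \<open>Inr (Some b)\<close>, and \<open>Inr None\<close> is the point at
  infinity.\<close>

definition mrowka :: "('b \<Rightarrow> 'a set) \<Rightarrow> ('a + 'b option) topology" where
  "mrowka S = topology (\<lambda>U.
     (\<forall>b. Inr (Some b) \<in> U \<longrightarrow> finite {a \<in> S b. Inl a \<notin> U}) \<and>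
     (Inr None \<in> U \<longrightarrow> (\<exists>T. finite T \<and> (\<forall>b. Inr (Some b) \<notin> U \<longrightarrow> b \<in> T) \<and>
        finite ({a. Inl a \<notin> U} - \<Union>(S ` T)))))"

text \<open>\<open>topology\<close> has the intended open sets only once its argument is known to be
  closed under unions and finite intersections. At infinity, the exceptional index sets
  \<open>T\<close> are united under intersection; the condition there says that finitely many sets
  \<open>S b\<close> with their limit points, and finitely many further points, cover the complement
  of \<open>U\<close>.\<close>

lemma openin_mrowka:
  "openin (mrowka S) U \<longleftrightarrow>
     (\<forall>b. Inr (Some b) \<in> U \<longrightarrow> finite {a \<in> S b. Inl a \<notin> U}) \<and>
     (Inr None \<in> U \<longrightarrow> (\<exists>T. finite T \<and> (\<forall>b. Inr (Some b) \<notin> U \<longrightarrow> b \<in> T) \<and>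
        finite ({a. Inl a \<notin> U} - \<Union>(S ` T))))"
proof -
  define P where "P U b \<longleftrightarrow> (Inr (Some b) \<in> U \<longrightarrow> finite {a \<in> S b. Inl a \<notin> U})"
    for U :: "('a + 'b option) set" and b
  define R where "R U T \<longleftrightarrow> finite T \<and> (\<forall>b. Inr (Some b) \<notin> U \<longrightarrow> b \<in> T) \<and>
        finite ({a. Inl a \<notin> U} - \<Union>(S ` T))" for U :: "('a + 'b option) set" and T
  have inter: "P (U \<inter> V) b" if "P U b" "P V b" for U V b
  proof -
    have "{a \<in> S b. Inl a \<notin> U \<inter> V} = {a \<in> S b. Inl a \<notin> U} \<union> {a \<in> S b. Inl a \<notin> V}" by blast
    then show ?thesis using that by (simp add: P_def)
  qed
  have inter': "R (U \<inter> V) (T \<union> T')" if "R U T" "R V T'" for U V T T'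
  proof -
    have "{a. Inl a \<notin> U \<inter> V} - \<Union>(S ` (T \<union> T')) \<subseteq>
        ({a. Inl a \<notin> U} - \<Union>(S ` T)) \<union> ({a. Inl a \<notin> V} - \<Union>(S ` T'))" by blast
    then show ?thesis using that unfolding R_def
      by (metis (no_types, lifting) Int_iff UnCI finite_UnI finite_subset)
  qed
  \<comment> \<open>\<open>P U b\<close> is vacuous when the point lies outside \<open>U\<close>, so
    monotonicity requires it to lie in \<open>U\<close>.\<close>
  have mono: "P V b" if "P U b" "U \<subseteq> V" "Inr (Some b) \<in> U" for U V b
    using that unfolding P_def by (auto intro: rev_finite_subset)
  have mono': "R V T" if "R U T" "U \<subseteq> V" for U V T
  proof -
    have "{a. Inl a \<notin> V} - \<Union>(S ` T) \<subseteq> {a. Inl a \<notin> U} - \<Union>(S ` T)" using that by blast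
    then show ?thesis using that unfolding R_def by (meson finite_subset subsetD)
  qed
  have "istopology (\<lambda>U. (\<forall>b. P U b) \<and> (Inr None \<in> U \<longrightarrow> (\<exists>T. R U T)))"
    unfolding istopology_def
  proof (intro conjI allI impI)
    fix K :: "('a + 'b option) set set" and b
    assume K: "\<forall>U\<in>K. (\<forall>b. P U b) \<and> (Inr None \<in> U \<longrightarrow> (\<exists>T. R U T))"
    show "P (\<Union>K) b"
    proof (cases "Inr (Some b) \<in> \<Union>K")
      case True
      then obtain U where "U \<in> K" "Inr (Some b) \<in> U" by blast
      then show ?thesis using mono[of U b "\<Union>K"] K by blast
    qed (simp add: P_def)
    assume "Inr None \<in> \<Union>K"
    then obtain U T where "U \<in> K" "R U T" using K by blast
    then show "\<exists>T. R (\<Union>K) T" using mono'[of U T "\<Union>K"] by blast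
  next
    fix U V b
    assume "(\<forall>b. P U b) \<and> (Inr None \<in> U \<longrightarrow> (\<exists>T. R U T))"
      and "(\<forall>b. P V b) \<and> (Inr None \<in> V \<longrightarrow> (\<exists>T. R V T))"
    then show "P (U \<inter> V) b" and "Inr None \<in> U \<inter> V \<Longrightarrow> \<exists>T. R (U \<inter> V) T"
      using inter inter' by blast+
  qed
  then show ?thesis unfolding mrowka_def P_def R_def by (simp add: topology_inverse')
qed

lemma topspace_mrowka [simp]: "topspace (mrowka S) = UNIV"
proof -
  have "openin (mrowka S) UNIV" by (auto simp: openin_mrowka)
  then show ?thesis using openin_subset by fastforce
qed

lemma openin_mrowka_point: "openin (mrowka S) {Inl a}"
  by (simp add: openin_mrowka)

lemma openin_mrowka_nbhd: "openin (mrowka S) (insert (Inr (Some b)) (Inl ` (S b - A)))"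
  if "finite A"
proof -
  have "{a. a \<in> S b \<and> (a \<in> S b \<longrightarrow> a \<in> A)} \<subseteq> A" by blast
  then show ?thesis
    using that finite_subset by (auto simp: openin_mrowka image_iff)
qed

text \<open>By almost disjointness, removing \<open>S b\<close> costs any other \<open>S b'\<close>
  only finitely many points, and at infinity \<open>T = {b}\<close> accounts for everything removed.
  The basic neighbourhood of \<open>b\<close> is thus clopen.\<close>

lemma closedin_mrowka_nbhd:
  assumes ad: "\<And>b b'. b \<noteq> b' \<Longrightarrow> finite (S b \<inter> S b')"
  shows "openin (mrowka S) (- insert (Inr (Some b)) (Inl ` S b))"
proof -
  have "finite {a \<in> S b'. a \<in> S b}" if "b' \<noteq> b" for b'
    using ad[OF that] by (simp add: Int_def)
  moreover have "{a. a \<in> S b} - \<Union>(S ` {b}) = {}" by auto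
  ultimately show ?thesis
    unfolding openin_mrowka by (auto simp: image_iff intro!: exI[of _ "{b}"])
qed

text \<open>Of two distinct points, at least one is not the point at infinity, and it can be chosen
  with a clopen neighbourhood that misses the other: a singleton, or \<open>S b\<close> with its
  limit point.\<close>

lemma Hausdorff_mrowka:
  fixes S :: "'b \<Rightarrow> 'a set"
  assumes ad: "\<And>b b'. b \<noteq> b' \<Longrightarrow> finite (S b \<inter> S b')"
  shows "Hausdorff_space (mrowka S)"
proof -
  define sep where "sep p q \<longleftrightarrow> (\<exists>U V. openin (mrowka S) U \<and> openin (mrowka S) V \<and>
      p \<in> U \<and> q \<in> V \<and> disjnt U V)" for p q
  have sym: "sep q p" if "sep p q" for p q
    using that unfolding sep_def by (metis disjnt_sym)
  have clopen: "sep p q" if "openin (mrowka S) U" "openin (mrowka S) (- U)" "p \<in> U" "q \<notin> U" for p q U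
    using that unfolding sep_def by (metis ComplI disjnt_def Compl_disjoint)
  have "finite {a'. a' \<in> S b \<and> a' = a}" for a b by (rule finite_subset[of _ "{a}"]) auto
  then have "openin (mrowka S) (- {Inl a})" for a
    by (auto simp: openin_mrowka intro!: exI[of _ "{}"])
  then have 1: "sep (Inl a) q" if "q \<noteq> Inl a" for a q
    using clopen[of "{Inl a}" "Inl a" q] that openin_mrowka_point[of S a] by simp
  have 2: "sep (Inr (Some b)) (Inr c)" if "c \<noteq> Some b" for b c
  proof (rule clopen)
    show "openin (mrowka S) (insert (Inr (Some b)) (Inl ` S b))"
      using openin_mrowka_nbhd[of "{}" S b] by simp
    show "openin (mrowka S) (- insert (Inr (Some b)) (Inl ` S b))"
      using ad by (rule closedin_mrowka_nbhd)
  qed (use that in auto)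
  have 3: "sep (Inr c) (Inr d)" if "c \<noteq> d" for c d
    using 2[of d] sym[OF 2[of c]] that by (cases c; cases d) auto
  have "sep p q" if "p \<noteq> q" for p q
    using 1[of q] sym[OF 1[of p]] 3 that by (cases p; cases q) auto
  then show ?thesis unfolding Hausdorff_space_def sep_def by blast
qed

section \<open>Convergence and sequential compactness in the Mrowka-Isbell space\<close>

text \<open>A neighbourhood of infinity omits only points of finitely many sets \<open>S b\<close>,
  some of their limit points and finitely many other isolated points. Each of these is avoided by
  almost all \<open>x\<close>, and finitely many such conditions combine.\<close>

lemma converges_mrowka_infinity:
  assumes "\<And>a. almost_all_nsets n C (\<lambda>x. f x \<noteq> Inl a)"
    and "\<And>b. almost_all_nsets n C (\<lambda>x. f x \<noteq> Inr (Some b))"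
    and "\<And>b. almost_all_nsets n C (\<lambda>x. f x \<notin> Inl ` S b)"
  shows "nset_converges (mrowka S) n C f (Inr None)"
  unfolding nset_converges_iff
proof (intro conjI allI impI)
  fix U assume U: "openin (mrowka S) U \<and> Inr None \<in> U"
  then obtain T where T: "finite T" "\<And>b. Inr (Some b) \<notin> U \<Longrightarrow> b \<in> T"
    "finite ({a. Inl a \<notin> U} - \<Union>(S ` T))" unfolding openin_mrowka by blast
  have "almost_all_nsets n C (\<lambda>x. \<forall>a\<in>{a. Inl a \<notin> U} - \<Union>(S ` T). f x \<noteq> Inl a)"
    using T(3) assms(1) by (rule almost_all_nsets_Ball)
  moreover have "almost_all_nsets n C (\<lambda>x. \<forall>b\<in>T. f x \<noteq> Inr (Some b) \<and> f x \<notin> Inl ` S b)"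
    using T(1) assms(2,3) by (intro almost_all_nsets_Ball almost_all_nsets_conj)
  ultimately have "almost_all_nsets n C (\<lambda>x. (\<forall>a\<in>{a. Inl a \<notin> U} - \<Union>(S ` T). f x \<noteq> Inl a) \<and>
      (\<forall>b\<in>T. f x \<noteq> Inr (Some b) \<and> f x \<notin> Inl ` S b))"
    by (rule almost_all_nsets_conj)
  then show "almost_all_nsets n C (\<lambda>x. f x \<in> U)"
  proof (rule almost_all_nsets_mono)
    fix x assume *: "(\<forall>a\<in>{a. Inl a \<notin> U} - \<Union>(S ` T). f x \<noteq> Inl a) \<and>
      (\<forall>b\<in>T. f x \<noteq> Inr (Some b) \<and> f x \<notin> Inl ` S b)"
    show "f x \<in> U"
    proof (cases "f x")
      case (Inl a)
      then show ?thesis using * by auto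
    next
      case (Inr c)
      then show ?thesis using * T(2) U by (cases c) auto
    qed
  qed simp
qed simp

lemma converges_mrowka_point:
  assumes "\<And>a. almost_all_nsets n C (\<lambda>x. f x \<noteq> Inl a)"
    and "\<And>x. x \<in> nsets C n \<Longrightarrow> f x \<in> Inl ` S b"
  shows "nset_converges (mrowka S) n C f (Inr (Some b))"
  unfolding nset_converges_iff
proof (intro conjI allI impI)
  fix U assume U: "openin (mrowka S) U \<and> Inr (Some b) \<in> U"
  then have "finite {a \<in> S b. Inl a \<notin> U}" unfolding openin_mrowka by blast
  then have "almost_all_nsets n C (\<lambda>x. \<forall>a\<in>{a \<in> S b. Inl a \<notin> U}. f x \<noteq> Inl a)"
    using assms(1) by (rule almost_all_nsets_Ball)
  then show "almost_all_nsets n C (\<lambda>x. f x \<in> U)"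
  proof (rule almost_all_nsets_mono)
    fix x assume "x \<in> nsets C n" "\<forall>a\<in>{a \<in> S b. Inl a \<notin> U}. f x \<noteq> Inl a"
    then show "f x \<in> U" using assms(2)[of x] by auto
  qed simp
qed simp

text \<open>After thinning, \<open>f\<close> is constant or avoids each value almost everywhere, and
  its values are all isolated or all non-isolated. Non-isolated values tend to infinity; for
  isolated ones the hypothesis selects a limit, the point of some \<open>S b\<close> or
  infinity.\<close>

lemma n_sequentially_compact_mrowka:
  fixes S :: "'b \<Rightarrow> 'a set"
  assumes "\<And>B f. infinite B \<Longrightarrow> (\<And>a. almost_all_nsets n B (\<lambda>x. f x \<noteq> a)) \<Longrightarrow>
     \<exists>C\<subseteq>B. infinite C \<and> ((\<exists>b. \<forall>x\<in>nsets C n. f x \<in> S b) \<or>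
       (\<forall>b. almost_all_nsets n C (\<lambda>x. f x \<notin> S b)))"
  shows "n_sequentially_compact n (mrowka S)"
  unfolding n_sequentially_compact_def
proof
  fix f :: "nat set \<Rightarrow> 'a + 'b option"
  let ?r = "f ` nsets UNIV n"
  have "nsets (UNIV :: nat set) n \<subseteq> {A. finite A}" by (auto simp: nsets_def)
  then have "countable (nsets (UNIV :: nat set) n)"
    using countable_Collect_finite countable_subset by blast
  then have r: "countable ?r" by (rule countable_image)
  \<comment> \<open>Enumerating the countably many values of \<open>f\<close> makes the dichotomy
    for a sequence of properties applicable.\<close>
  obtain C :: "nat set" where C: "infinite C" and
    dich: "(\<exists>k. \<forall>x\<in>nsets C n. f x = from_nat_into ?r k) \<or>
      (\<forall>k. almost_all_nsets n C (\<lambda>x. f x \<noteq> from_nat_into ?r k))"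
    using homogeneous_or_avoiding[of UNIV n "\<lambda>k x. f x = from_nat_into ?r k"] by auto
  from dich show "\<exists>B. infinite B \<and> (\<exists>p. nset_converges (mrowka S) n B f p)"
  proof
    assume "\<exists>k. \<forall>x\<in>nsets C n. f x = from_nat_into ?r k"
    then obtain p where "\<forall>x\<in>nsets C n. f x = p" by blast
    then have "nset_converges (mrowka S) n C f p"
      unfolding nset_converges_iff by (auto intro: almost_all_nsetsI)
    then show ?thesis using C by blast
  next
    assume avoid: "\<forall>k. almost_all_nsets n C (\<lambda>x. f x \<noteq> from_nat_into ?r k)"
    have ne: "almost_all_nsets n C (\<lambda>x. f x \<noteq> p)" for p
    proof (cases "p \<in> ?r")
      case True
      then show ?thesis using avoid from_nat_into_surj[OF r] by metis
    next
      case False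
      then show ?thesis by (intro almost_all_nsetsI) (auto simp: nsets_def)
    qed
    obtain D where D: "D \<subseteq> C" "infinite D"
      "(\<forall>x\<in>nsets D n. f x \<in> range Inl) \<or> (\<forall>x\<in>nsets D n. f x \<notin> range Inl)"
      using Ramsey_dichotomy[OF C, of n "\<lambda>x. f x \<in> range Inl"] by blast
    have neD: "almost_all_nsets n D (\<lambda>x. f x \<noteq> p)" for p
      using ne D(1) by (rule almost_all_nsets_mono)
    from D(3) show ?thesis
    proof
      assume "\<forall>x\<in>nsets D n. f x \<notin> range Inl"
      then have "nset_converges (mrowka S) n D f (Inr None)"
        by (intro converges_mrowka_infinity neD almost_all_nsetsI) blast
      then show ?thesis using D(2) by blast
    next
      assume inl: "\<forall>x\<in>nsets D n. f x \<in> range Inl"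
      have "almost_all_nsets n D (\<lambda>x. projl (f x) \<noteq> a)" for a
        by (rule almost_all_nsets_mono[OF neD[of "Inl a"]]) (use inl in auto)
      then obtain E where E: "E \<subseteq> D" "infinite E"
        "(\<exists>b. \<forall>x\<in>nsets E n. projl (f x) \<in> S b) \<or>
         (\<forall>b. almost_all_nsets n E (\<lambda>x. projl (f x) \<notin> S b))"
        using assms[OF D(2), of "\<lambda>x. projl (f x)"] by blast
      have neE: "almost_all_nsets n E (\<lambda>x. f x \<noteq> p)" for p
        using neD E(1) by (rule almost_all_nsets_mono)
      have inlE: "f x \<in> range Inl" if "x \<in> nsets E n" for x
        using inl in_nsets_mono[OF that E(1)] by blast
      have iff: "projl (f x) \<in> A \<longleftrightarrow> f x \<in> Inl ` A" if "x \<in> nsets E n" for x A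
        using inlE[OF that] by auto
      from E(3) have "\<exists>p. nset_converges (mrowka S) n E f p"
      proof
        assume "\<exists>b. \<forall>x\<in>nsets E n. projl (f x) \<in> S b"
        then show ?thesis using iff by (blast intro: converges_mrowka_point neE)
      next
        assume *: "\<forall>b. almost_all_nsets n E (\<lambda>x. projl (f x) \<notin> S b)"
        have "almost_all_nsets n E (\<lambda>x. f x \<notin> Inl ` S b)" for b
          by (rule almost_all_nsets_mono[OF *[rule_format, of b]]) (simp_all add: iff)
        then show ?thesis by (blast intro: converges_mrowka_infinity neE)
      qed
      then show ?thesis using E(2) by blast
    qed
  qed
qed

text \<open>The first three hypotheses exclude the three kinds of limit: an isolated point, the
  point of some \<open>S b\<close>, and infinity. For infinity, the complement of a clopen
  neighbourhood of \<open>b\<close> is a neighbourhood that \<open>f\<close> does not eventually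
  enter.\<close>

lemma not_n_sequentially_compact_mrowka:
  fixes S :: "'b \<Rightarrow> 'a set" and f :: "nat set \<Rightarrow> 'a"
  assumes point: "\<And>a B. infinite B \<Longrightarrow> \<not> almost_all_nsets n B (\<lambda>x. f x = a)"
    and set: "\<And>b B. infinite B \<Longrightarrow> \<not> almost_all_nsets n B (\<lambda>x. f x \<in> S b)"
    and comp: "\<And>B. infinite B \<Longrightarrow> \<exists>b. \<not> almost_all_nsets n B (\<lambda>x. f x \<notin> S b)"
    and ad: "\<And>b b'. b \<noteq> b' \<Longrightarrow> finite (S b \<inter> S b')"
  shows "\<not> n_sequentially_compact n (mrowka S)"
proof
  assume "n_sequentially_compact n (mrowka S)"
  then obtain B p where B: "infinite B" and conv: "nset_converges (mrowka S) n B (\<lambda>x. Inl (f x)) p"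
    unfolding n_sequentially_compact_def topspace_mrowka by (meson Pi_I UNIV_I)
  have nbhd: "almost_all_nsets n B (\<lambda>x. Inl (f x) \<in> U)" if "openin (mrowka S) U" "p \<in> U" for U
    using conv that unfolding nset_converges_iff by blast
  show False
  proof (cases p)
    case (Inl a)
    then show ?thesis using nbhd[OF openin_mrowka_point[of S a]] point[OF B] by simp
  next
    case (Inr c)
    show ?thesis
    proof (cases c)
      case None
      obtain b where "\<not> almost_all_nsets n B (\<lambda>x. f x \<notin> S b)" using comp[OF B] by blast
      moreover have "almost_all_nsets n B (\<lambda>x. Inl (f x) \<in> - insert (Inr (Some b)) (Inl ` S b))"
        by (rule nbhd[OF closedin_mrowka_nbhd[OF ad]]) (auto simp: Inr None)
      ultimately show ?thesis by (simp add: image_iff)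
    next
      case (Some b)
      have "almost_all_nsets n B (\<lambda>x. Inl (f x) \<in> insert (Inr (Some b)) (Inl ` (S b - {})))"
        by (rule nbhd[OF openin_mrowka_nbhd]) (auto simp: Inr Some)
      then show ?thesis using set[OF B, of b] by (simp add: image_iff)
    qed
  qed
qed

section \<open>Transfer of a topology along a bijection\<close>

text \<open>Serves to move a space from the sum type on which it is built to \<open>omega1\<close>:
  the pullback along a bijection is a homeomorphic copy.\<close>

lemma bijection_topology_transfer:
  fixes X :: "'p topology" and e :: "'q \<Rightarrow> 'p"
  assumes e: "bij e" and top: "topspace X = UNIV" and H: "Hausdorff_space X"
  shows "\<exists>Y :: 'q topology. Hausdorff_space Y \<and> topspace Y = UNIV \<and>
    (\<forall>n. n_sequentially_compact n Y \<longleftrightarrow> n_sequentially_compact n X)"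
proof -
  define Y where "Y = pullback_topology UNIV e X"
  have openY: "openin Y (e -` U) \<longleftrightarrow> openin X U" for U
  proof -
    have "U = V" if "e -` U = e -` V" for V
      using that surj_image_vimage_eq[OF bij_is_surj[OF e]] by metis
    then show ?thesis unfolding Y_def openin_pullback_topology by auto
  qed
  have openY': "openin Y V \<longleftrightarrow> openin X (e ` V)" for V
    using openY[of "e ` V"] e by (simp add: bij_is_inj inj_vimage_image_eq)
  have topY: "topspace Y = UNIV"
  proof -
    have "openin Y UNIV" using openY[of UNIV] openin_topspace[of X] top by simp
    then show ?thesis using openin_subset by blast
  qed
  have conv: "nset_converges Y n B f p \<longleftrightarrow> nset_converges X n B (e \<circ> f) (e p)"
    for n and B :: "nat set" and f p
  proof -
    have "(\<forall>V. openin Y V \<and> p \<in> V \<longrightarrow> almost_all_nsets n B (\<lambda>x. f x \<in> V)) \<longleftrightarrow>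
        (\<forall>U. openin X U \<and> e p \<in> U \<longrightarrow> almost_all_nsets n B (\<lambda>x. e (f x) \<in> U))" (is "?L \<longleftrightarrow> ?R")
    proof
      assume ?L
      then have "almost_all_nsets n B (\<lambda>x. f x \<in> e -` U)" if "openin X U \<and> e p \<in> U" for U
        using that openY[of U] by blast
      then show ?R by simp
    next
      assume R: ?R
      show ?L
      proof (intro allI impI)
        fix V assume "openin Y V \<and> p \<in> V"
        then have "almost_all_nsets n B (\<lambda>x. e (f x) \<in> e ` V)" using R openY' by blast
        then show "almost_all_nsets n B (\<lambda>x. f x \<in> V)"
          using bij_is_inj[OF e] by (simp add: inj_image_mem_iff)
      qed
    qed
    then show ?thesis by (simp add: nset_converges_iff top topY)
  qed
  have "n_sequentially_compact n Y \<longleftrightarrow> n_sequentially_compact n X" for n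
  proof
    assume Y: "n_sequentially_compact n Y"
    show "n_sequentially_compact n X"
      unfolding n_sequentially_compact_def
    proof
      fix f :: "nat set \<Rightarrow> 'p"
      obtain B p where "infinite B" "nset_converges Y n B (inv e \<circ> f) p"
        using Y unfolding n_sequentially_compact_def topY by (meson Pi_I UNIV_I)
      moreover have "e \<circ> (inv e \<circ> f) = f"
        using bij_is_surj[OF e] by (auto simp: fun_eq_iff surj_f_inv_f)
      ultimately show "\<exists>B. infinite B \<and> (\<exists>p. nset_converges X n B f p)"
        using conv by metis
    qed
  next
    assume X: "n_sequentially_compact n X"
    show "n_sequentially_compact n Y"
      unfolding n_sequentially_compact_def
    proof
      fix f :: "nat set \<Rightarrow> 'q"
      obtain B p where "infinite B" "nset_converges X n B (e \<circ> f) p"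
        using X unfolding n_sequentially_compact_def top by (meson Pi_I UNIV_I)
      then show "\<exists>B. infinite B \<and> (\<exists>p. nset_converges Y n B f p)"
        using conv bij_is_surj[OF e] by (metis surjD)
    qed
  qed
  moreover have "Hausdorff_space Y"
    unfolding Hausdorff_space_def
  proof (intro allI impI)
    fix x y assume "x \<in> topspace Y \<and> y \<in> topspace Y \<and> x \<noteq> y"
    then have "e x \<noteq> e y" using bij_is_inj[OF e] by (simp add: inj_eq)
    then obtain U V where "openin X U" "openin X V" "e x \<in> U" "e y \<in> V" "disjnt U V"
      using H top unfolding Hausdorff_space_def by (metis UNIV_I)
    then show "\<exists>U V. openin Y U \<and> openin Y V \<and> x \<in> U \<and> y \<in> V \<and> disjnt U V"
      using openY by (intro exI[of _ "e -` U"] exI[of _ "e -` V"]) (auto simp: disjnt_def)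
  qed
  ultimately show ?thesis using topY by blast
qed

section \<open>Sparse increasing lists and guess sets\<close>

definition increasing_list :: "nat \<Rightarrow> nat list \<Rightarrow> bool" where
  "increasing_list n ys \<longleftrightarrow> length ys = Suc n \<and> sorted_wrt (<) ys"

text \<open>The number \<open>j\<close> measures the sparseness: each of the \<open>n\<close> jumps
  exceeds the first \<open>j\<close> functions. The bound \<open>j \<le> ys ! 0\<close> leaves
  finitely many possible \<open>j\<close> for a given first entry.\<close>

definition sparse_list :: "nat \<Rightarrow> (nat \<Rightarrow> nat \<Rightarrow> nat) \<Rightarrow> nat \<Rightarrow> nat list \<Rightarrow> bool" where
  "sparse_list n u j ys \<longleftrightarrow> increasing_list n ys \<and> j \<le> ys ! 0 \<and>
     (\<forall>i<n. \<forall>l<j. u l (ys ! i) < ys ! Suc i)"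

text \<open>The guess \<gamma> is evaluated at the same \<open>j\<close> that witnesses sparseness,
  so each \<open>j\<close> contributes only finitely many lists.\<close>

definition guess_set :: "nat \<Rightarrow> (nat \<Rightarrow> nat \<Rightarrow> nat) \<Rightarrow> (nat \<Rightarrow> nat) \<Rightarrow> nat list set" where
  "guess_set n u \<gamma> = {ys. \<exists>j. sparse_list n u j ys \<and> ys ! n \<le> \<gamma> j}"

lemma increasing_list_nth_mono:
  assumes "increasing_list n ys" "i \<le> k" "k \<le> n"
  shows "ys ! i \<le> ys ! k"
  using assms unfolding increasing_list_def
  by (cases "i = k") (auto dest: sorted_wrt_nth_less[of "(<)" ys i k])

lemma finite_increasing_lists: "finite {ys. increasing_list n ys \<and> ys ! n \<le> m}"
proof (rule finite_subset)
  show "{ys. increasing_list n ys \<and> ys ! n \<le> m} \<subseteq> {ys. set ys \<subseteq> {..m} \<and> length ys = Suc n}"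
  proof clarify
    fix ys assume ys: "increasing_list n ys" "ys ! n \<le> m"
    have "ys ! i \<le> m" if "i \<le> n" for i
      using increasing_list_nth_mono[OF ys(1) that] ys(2) by simp
    then show "set ys \<subseteq> {..m} \<and> length ys = Suc n"
      using ys(1) by (auto simp: increasing_list_def in_set_conv_nth)
  qed
qed (simp add: finite_lists_length_eq)

text \<open>Summing \<gamma> over all possible witnesses \<open>j \<le> ys ! 0\<close> eliminates
  the unknown witness and bounds the last entry by a function of the first; almost disjointness
  rests on this.\<close>

lemma guess_set_last_le:
  assumes "ys \<in> guess_set n u \<gamma>"
  shows "increasing_list n ys" "ys ! n \<le> (\<Sum>j\<le>ys ! 0. \<gamma> j)"
proof -
  obtain j where j: "sparse_list n u j ys" "ys ! n \<le> \<gamma> j"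
    using assms by (auto simp: guess_set_def)
  then show "increasing_list n ys" by (simp add: sparse_list_def)
  have "\<gamma> j \<le> (\<Sum>j\<le>ys ! 0. \<gamma> j)"
    using j(1) by (intro member_le_sum) (auto simp: sparse_list_def)
  then show "ys ! n \<le> (\<Sum>j\<le>ys ! 0. \<gamma> j)" using j(2) by simp
qed

lemma finite_guess_set_hd: "finite {ys \<in> guess_set n u \<gamma>. ys ! 0 \<le> c}"
proof (rule finite_subset)
  show "{ys \<in> guess_set n u \<gamma>. ys ! 0 \<le> c} \<subseteq>
      {ys. increasing_list n ys \<and> ys ! n \<le> (\<Sum>j\<le>c. \<gamma> j)}"
  proof clarify
    fix ys assume ys: "ys \<in> guess_set n u \<gamma>" "ys ! 0 \<le> c"
    have "(\<Sum>j\<le>ys ! 0. \<gamma> j) \<le> (\<Sum>j\<le>c. \<gamma> j)"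
      using ys(2) by (intro sum_mono2) auto
    then show "increasing_list n ys \<and> ys ! n \<le> (\<Sum>j\<le>c. \<gamma> j)"
      using guess_set_last_le[OF ys(1)] by simp
  qed
qed (rule finite_increasing_lists)

text \<open>If \<open>h\<close> is dominated by the \<open>l\<close>-th function, then a sparse list with \<open>j > l\<close> jumps above \<open>h\<close>
  except at the finitely many places where the domination fails, and only finitely many lists have
  a witness \<open>j \<le> l\<close>.\<close>

lemma finite_guess_set_slow:
  assumes "h \<le>\<^sup>* u l"
  shows "finite {ys \<in> guess_set n u \<gamma>. \<exists>i<n. ys ! Suc i \<le> h (ys ! i)}"
proof -
  obtain c where c: "{k. h k > u l k} \<subseteq> {..c}"
    using assms unfolding le_star_def by (auto simp: finite_nat_iff_bounded_le)
  have "{ys \<in> guess_set n u \<gamma>. \<exists>i<n. ys ! Suc i \<le> h (ys ! i)} \<subseteq>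
      {ys \<in> guess_set n u \<gamma>. ys ! 0 \<le> c} \<union> {ys. increasing_list n ys \<and> ys ! n \<le> (\<Sum>j\<le>l. \<gamma> j)}"
  proof
    fix ys assume "ys \<in> {ys \<in> guess_set n u \<gamma>. \<exists>i<n. ys ! Suc i \<le> h (ys ! i)}"
    then obtain i j where ys: "ys \<in> guess_set n u \<gamma>" and i: "i < n" "ys ! Suc i \<le> h (ys ! i)"
      and j: "sparse_list n u j ys" "ys ! n \<le> \<gamma> j"
      by (auto simp: guess_set_def)
    have inc: "increasing_list n ys" using j(1) by (simp add: sparse_list_def)
    show "ys \<in> {ys \<in> guess_set n u \<gamma>. ys ! 0 \<le> c} \<union> {ys. increasing_list n ys \<and> ys ! n \<le> (\<Sum>j\<le>l. \<gamma> j)}"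
    proof (cases "l < j")
      case True
      then have "u l (ys ! i) < h (ys ! i)" using j(1) i by (fastforce simp: sparse_list_def)
      then have "ys ! i \<le> c" using c by auto
      then have "ys ! 0 \<le> c" using increasing_list_nth_mono[OF inc, of 0 i] i(1) by simp
      then show ?thesis using ys by simp
    next
      case False
      then have "\<gamma> j \<le> (\<Sum>j\<le>l. \<gamma> j)" by (intro member_le_sum) auto
      then show ?thesis using inc j(2) by simp
    qed
  qed
  then show ?thesis
    by (rule finite_subset) (simp add: finite_guess_set_hd finite_increasing_lists)
qed

text \<open>Elements of \<open>D\<close> are appended one at a time. Only \<open>j\<close> functions
  have to be exceeded, at the current last entry, so any element beyond their sum and that entry
  will do.\<close>

lemma ex_sparse_list:
  assumes D: "infinite D"
  shows "\<exists>ys. sparse_list n u j ys \<and> set ys \<subseteq> D"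
proof (induction n)
  case 0
  obtain c where "c \<in> D" "j < c" using D infinite_nat_iff_unbounded by blast
  then show ?case by (intro exI[of _ "[c]"]) (simp add: sparse_list_def increasing_list_def)
next
  case (Suc n)
  then obtain ys where ys: "sparse_list n u j ys" "set ys \<subseteq> D" by blast
  then have inc: "increasing_list n ys" and len: "length ys = Suc n"
    by (auto simp: sparse_list_def increasing_list_def)
  obtain c where c: "c \<in> D" "ys ! n + (\<Sum>l<j. u l (ys ! n)) < c"
    using D infinite_nat_iff_unbounded by blast
  have "y < c" if y: "y \<in> set ys" for y
  proof -
    obtain i where "i < length ys" "y = ys ! i" using y by (auto simp: in_set_conv_nth)
    then show ?thesis using increasing_list_nth_mono[OF inc, of i n] len c(2) by simp
  qed
  then have inc': "increasing_list (Suc n) (ys @ [c])"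
    using inc by (simp add: increasing_list_def sorted_wrt_append)
  have "u l ((ys @ [c]) ! i) < (ys @ [c]) ! Suc i" if "i < Suc n" "l < j" for i l
  proof (cases "i = n")
    case True
    have "u l (ys ! n) \<le> (\<Sum>l<j. u l (ys ! n))" using that by (intro member_le_sum) auto
    then show ?thesis using True len c(2) by (simp add: nth_append)
  next
    case False
    then show ?thesis using that ys(1) len by (simp add: nth_append sparse_list_def)
  qed
  moreover have "j \<le> (ys @ [c]) ! 0" using ys(1) len by (simp add: nth_append sparse_list_def)
  ultimately have "sparse_list (Suc n) u j (ys @ [c])" using inc' by (simp add: sparse_list_def)
  then show ?case using ys(2) c(1) by (intro exI[of _ "ys @ [c]"]) simp
qed

section \<open>Closed unbounded sets and cardinality of omega1\<close>

text \<open>Otherwise countably many countable initial segments would cover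
  \<open>omega1\<close>.\<close>

lemma countable_bounded_omega1:
  fixes A :: "omega1 set"
  assumes "countable A"
  shows "\<exists>b. \<forall>a\<in>A. a < b"
proof (rule ccontr)
  assume "\<not> ?thesis"
  then have "UNIV = (\<Union>a\<in>A. {..a})" by (auto simp: not_less)
  moreover have "countable {..a}" for a :: omega1
    using countable_lessThan_omega1[of a] by (simp add: ivl_disj_un(2)[symmetric])
  ultimately show False using uncountable_omega1 assms by (metis countable_UN)
qed

text \<open>For unboundedness, a function \<open>s\<close> that exceeds both its argument and all
  earlier values of \<phi> is iterated; the supremum of the iterates is closed under \<phi>. A limit
  of closure points is again one.\<close>

lemma closed_unbounded_closure_points:
  fixes \<phi> :: "omega1 \<Rightarrow> omega1"
  shows "closed_unbounded {d. d0 < d \<and> (\<forall>b<d. \<phi> b < d)}"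
  unfolding closed_unbounded_def
proof (intro conjI allI impI)
  fix \<alpha> :: omega1
  have "\<exists>c. b < c \<and> (\<forall>a\<le>b. \<phi> a < c)" for b
  proof -
    have "{..b} = insert b {..<b}" by auto
    then have "countable ({b} \<union> \<phi> ` {..b})" using countable_lessThan_omega1 by simp
    from countable_bounded_omega1[OF this] show ?thesis by auto
  qed
  then obtain s where s: "\<And>b. b < s b" "\<And>a b. a \<le> b \<Longrightarrow> \<phi> a < s b" by metis
  define t where "t k = (s ^^ k) (max \<alpha> d0)" for k
  have t0: "t 0 = max \<alpha> d0" and tSuc: "t (Suc k) = s (t k)" for k by (simp_all add: t_def)
  have "\<exists>b. \<forall>a\<in>range t. a < b" by (rule countable_bounded_omega1) simp
  then have ex: "\<exists>b. \<forall>k. t k < b" by auto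
  \<comment> \<open>This is the supremum of the iterates: whatever lies below it is at most some
    \<open>t k\<close>, and its \<phi>-value is then below \<open>t (Suc k)\<close>.\<close>
  define d where "d = (LEAST b. \<forall>k. t k < b)"
  have d: "t k < d" for k using LeastI_ex[OF ex] unfolding d_def by blast
  have "\<phi> b < d" if "b < d" for b
  proof -
    have "\<not> (\<forall>k. t k < b)" using that not_less_Least unfolding d_def by blast
    then obtain k where "b \<le> t k" by (auto simp: not_less)
    then have "\<phi> b < t (Suc k)" using s(2) tSuc by simp
    then show ?thesis using d less_trans by blast
  qed
  then show "\<exists>d\<in>{d. d0 < d \<and> (\<forall>b<d. \<phi> b < d)}. \<alpha> < d"
    using d[of 0] t0 by auto
next
  fix \<alpha> :: omega1
  assume \<alpha>: "{..<\<alpha>} \<noteq> {} \<and>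
    (\<forall>\<beta><\<alpha>. \<exists>\<gamma>\<in>{d. d0 < d \<and> (\<forall>b<d. \<phi> b < d)}. \<beta> < \<gamma> \<and> \<gamma> < \<alpha>)"
  have lim: "\<exists>\<gamma>. d0 < \<gamma> \<and> (\<forall>b<\<gamma>. \<phi> b < \<gamma>) \<and> \<beta> < \<gamma> \<and> \<gamma> < \<alpha>" if "\<beta> < \<alpha>" for \<beta>
    using \<alpha> that by auto
  obtain \<beta> where "\<beta> < \<alpha>" using \<alpha> by auto
  from lim[OF this] have "d0 < \<alpha>" by auto
  moreover have "\<phi> b < \<alpha>" if "b < \<alpha>" for b using lim[OF that] by auto
  ultimately show "\<alpha> \<in> {d. d0 < d \<and> (\<forall>b<d. \<phi> b < d)}" by simp
qed

lemma ex_dominating_omega1: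
  assumes "dominating_number =o cardSuc natLeq"
  shows "\<exists>D :: omega1 \<Rightarrow> nat \<Rightarrow> nat. \<forall>f. \<exists>b. f \<le>\<^sup>* D b"
proof -
  define E where "E = (SOME D. dominating D \<and> (\<forall>E. dominating E \<longrightarrow> |D| \<le>o |E| ))"
  have E: "dominating E" using someI_ex[OF ex_minimal_dominating] unfolding E_def by simp
  have "|E| =o cardSuc natLeq" using assms unfolding dominating_number_def E_def .
  then have "|UNIV :: omega1 set| =o |E|"
    using card_of_omega1 ordIso_symmetric ordIso_transitive by blast
  then obtain D where "bij_betw D (UNIV :: omega1 set) E" using card_of_ordIso by blast
  then have "range D = E" by (simp add: bij_betw_def)
  then show ?thesis using E unfolding dominating_def by (intro exI[of _ D]) auto
qed

text \<open>The sum type is a copy of \<open>omega1\<close> together with countably many further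
  points.\<close>

lemma ex_bij_omega1: "\<exists>e :: omega1 \<Rightarrow> nat list + (nat + omega1) option. bij e"
proof -
  have inf: "infinite (UNIV :: omega1 set)" using uncountable_omega1 countable_finite by blast
  have ctbl: "|A| \<le>o |UNIV :: omega1 set|" if "countable A" for A :: "(nat list + (nat + omega1) option) set"
  proof -
    have "|A| \<le>o |UNIV :: nat set|" using that by (auto simp: countable_def card_of_ordLeq[symmetric])
    then show ?thesis using inf[unfolded infinite_iff_card_of_nat] by (rule ordLeq_transitive)
  qed
  let ?i = "\<lambda>a :: omega1. Inr (Some (Inr a)) :: nat list + (nat + omega1) option"
  have "x \<in> (range Inl \<union> range (\<lambda>k. Inr (Some (Inl k))) \<union> {Inr None}) \<union> range ?i"
    for x :: "nat list + (nat + omega1) option"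
  proof (cases x)
    case (Inr c)
    show ?thesis
    proof (cases c)
      case (Some d)
      then show ?thesis using Inr by (cases d) auto
    qed (simp add: Inr)
  qed simp
  then have eq: "UNIV = (range Inl \<union> range (\<lambda>k. Inr (Some (Inl k))) \<union> {Inr None}) \<union> range ?i"
    by blast
  have "|(range Inl \<union> range (\<lambda>k. Inr (Some (Inl k))) \<union> {Inr None}) \<union> range ?i| \<le>o |UNIV :: omega1 set|"
    by (rule card_of_Un_ordLeq_infinite_Field[OF _ ctbl card_of_image])
      (use inf card_of_Card_order[of "UNIV :: omega1 set"] in \<open>simp_all add: Field_card_of\<close>)
  then have "|UNIV :: (nat list + (nat + omega1) option) set| \<le>o |UNIV :: omega1 set|"
    unfolding eq .
  moreover have "inj ?i" by (simp add: inj_def)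
  then have "|UNIV :: omega1 set| \<le>o |UNIV :: (nat list + (nat + omega1) option) set|"
    by (intro card_of_ordLeq[THEN iffD1] exI[of _ ?i]) simp
  ultimately have "|UNIV :: omega1 set| =o |UNIV :: (nat list + (nat + omega1) option) set|"
    by (simp add: ordIso_iff_ordLeq)
  then show ?thesis using card_of_ordIso by blast
qed

section \<open>Borel maps and the guessing function\<close>

lemma sets_borel_of: "openin X U \<Longrightarrow> U \<in> sets (borel_of X)"
proof -
  assume U: "openin X U"
  have "{U. openin X U} \<subseteq> Pow (topspace X)" using openin_subset[of X] by auto
  then show ?thesis
    using U by (simp add: borel_of_def sets_measure_of sigma_sets.Basic)
qed

lemma space_borel_of [simp]: "space (borel_of X) = topspace X"
proof -
  have "{U. openin X U} \<subseteq> Pow (topspace X)" using openin_subset[of X] by auto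
  then show ?thesis by (simp add: borel_of_def space_measure_of)
qed

text \<open>For fixed \<open>m\<close> and \<open>y\<close> the condition concerns finitely many
  coordinates of \<open>p\<close> and is therefore Borel. The existential quantifier over
  \<open>y\<close> is a countable union, and a least number with a Borel property depends measurably
  on \<open>p\<close>.\<close>

lemma borel_levels_Least:
  fixes P :: "omega1 \<Rightarrow> nat \<Rightarrow> nat \<Rightarrow> 'a :: countable \<Rightarrow> bool" and A :: "omega1 \<Rightarrow> 'a \<Rightarrow> omega1 set"
  assumes fin: "\<And>d y. finite (A d y)"
  shows "borel_levels (\<lambda>d p j. LEAST m. \<exists>y. P d j m y \<and> (\<forall>a\<in>A d y. a < d \<and> p a))"
  unfolding borel_levels_def
proof (intro allI measurable_coordinatewise_then_product)
  fix d j
  let ?M = "borel_of (two_pow d)"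
  have coord: "{p \<in> topspace (two_pow d). p a} \<in> sets ?M" if "a < d" for a
  proof -
    have "continuous_map (two_pow d) (discrete_topology UNIV) (\<lambda>p. p a)"
      unfolding two_pow_def using that by (intro continuous_map_product_projection) simp
    from openin_continuous_map_preimage[OF this, of "{True}"]
    show ?thesis by (intro sets_borel_of) simp
  qed
  \<comment> \<open>For \<open>a\<close> outside the domain \<open>{..<d}\<close> the set is
    empty.\<close>
  have "{p \<in> space ?M. a < d \<and> p a} \<in> sets ?M" for a
    using coord[of a] by (cases "a < d") auto
  then have "{p \<in> space ?M. \<forall>a\<in>A d y. a < d \<and> p a} \<in> sets ?M" for y
    using fin by (rule sets.sets_Collect_finite_All)
  then have "{p \<in> space ?M. \<exists>y. P d j m y \<and> (\<forall>a\<in>A d y. a < d \<and> p a)} \<in> sets ?M" for m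
    by (intro sets.sets_Collect_countable_Ex sets.sets_Collect_conj sets.sets_Collect_const)
  then have "Measurable.pred ?M (\<lambda>p. \<exists>y. P d j m y \<and> (\<forall>a\<in>A d y. a < d \<and> p a))" for m
    unfolding pred_def .
  then have "(\<lambda>p. LEAST m. \<exists>y. P d j m y \<and> (\<forall>a\<in>A d y. a < d \<and> p a)) \<in> ?M \<rightarrow>\<^sub>M count_space UNIV"
    by (rule measurable_Least)
  from measurable_compose[OF this, of "\<lambda>x. x" borel]
  show "(\<lambda>p. LEAST m. \<exists>y. P d j m y \<and> (\<forall>a\<in>A d y. a < d \<and> p a)) \<in> borel_measurable ?M"
    by simp
qed

text \<open>The guessing function looks for the least bound on the last entry of a sparse list with
  entries in \<open>D\<close>, where \<open>D\<close> is coded on the image of an injection \<open>\<omega> \<rightarrow> \<omega>\<^sub>1\<close>.\<close>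

lemma diamond_b_guess:
  fixes u :: "omega1 \<Rightarrow> nat \<Rightarrow> nat \<Rightarrow> nat"
  assumes "diamond_b"
  shows "\<exists>g :: omega1 \<Rightarrow> nat \<Rightarrow> nat. \<forall>D \<phi> d0. infinite D \<longrightarrow>
    (\<exists>d>d0. (\<forall>b<d. \<phi> b < d) \<and>
      infinite {j. \<exists>ys. sparse_list n (u d) j ys \<and> set ys \<subseteq> D \<and> ys ! n \<le> g d j})"
proof -
  have inf: "infinite (UNIV :: omega1 set)" using uncountable_omega1 countable_finite by blast
  obtain e :: "nat \<Rightarrow> omega1" where e: "inj e"
    using infinite_countable_subset[OF inf] by blast
  define F where "F d p j =
    (LEAST m. \<exists>ys. (sparse_list n (u d) j ys \<and> ys ! n \<le> m) \<and> (\<forall>a\<in>e ` set ys. a < d \<and> p a))" for d p j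
  have "borel_levels (\<lambda>d p j. F d p j)"
    unfolding F_def by (rule borel_levels_Least) simp
  then obtain g :: "omega1 \<Rightarrow> nat \<Rightarrow> nat" where
    g: "\<And>f. stationary {\<alpha>. \<not> g \<alpha> \<le>\<^sup>* F \<alpha> (restrict f {..<\<alpha>})}"
    using assms unfolding diamond_b_def by blast
  have "\<exists>d>d0. (\<forall>b<d. \<phi> b < d) \<and>
      infinite {j. \<exists>ys. sparse_list n (u d) j ys \<and> set ys \<subseteq> D \<and> ys ! n \<le> g d j}"
    if D: "infinite D" for D \<phi> d0
  proof -
    \<comment> \<open>Beyond \<open>d1\<close>, which exceeds the range of \<open>e\<close>, the
      restriction of \<open>f\<close> to the predecessors of \<open>d\<close> already codes all of
      \<open>D\<close>.\<close>
    obtain d1 where d1: "d0 < d1" "\<And>k. e k < d1"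
      using countable_bounded_omega1[of "insert d0 (range e)"] by auto
    define f where "f \<alpha> \<longleftrightarrow> \<alpha> \<in> e ` D" for \<alpha>
    \<comment> \<open>The stationary set of successful guesses for \<open>f\<close> meets the closed
      unbounded set of closure points of \<phi> beyond \<open>d1\<close>.\<close>
    have "{\<alpha>. \<not> g \<alpha> \<le>\<^sup>* F \<alpha> (restrict f {..<\<alpha>})} \<inter> {d. d1 < d \<and> (\<forall>b<d. \<phi> b < d)} \<noteq> {}"
      using g[of f] closed_unbounded_closure_points[of d1 \<phi>] unfolding stationary_def by simp
    then obtain d where d: "\<not> g d \<le>\<^sup>* F d (restrict f {..<d})" "d1 < d" "\<forall>b<d. \<phi> b < d"
      by auto
    have restrict_f: "(\<forall>a\<in>e ` set ys. a < d \<and> restrict f {..<d} a) \<longleftrightarrow> set ys \<subseteq> D" for ys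
    proof -
      have "e k < d" for k using d1(2)[of k] d(2) by simp
      then have "(e k < d \<and> restrict f {..<d} (e k)) \<longleftrightarrow> k \<in> D" for k
        using e by (simp add: f_def inj_image_mem_iff)
      then show ?thesis by auto
    qed
    have "\<exists>ys. sparse_list n (u d) j ys \<and> set ys \<subseteq> D \<and> ys ! n \<le> g d j"
      if j: "g d j > F d (restrict f {..<d}) j" for j
    proof -
      let ?P = "\<lambda>m. \<exists>ys. (sparse_list n (u d) j ys \<and> ys ! n \<le> m) \<and>
          (\<forall>a\<in>e ` set ys. a < d \<and> restrict f {..<d} a)"
      \<comment> \<open>Since a sparse list in \<open>D\<close> exists, the \<open>LEAST\<close> in
        \<open>F\<close> is attained; a larger value of \<open>g\<close> then bounds the same
        list.\<close>
      have "\<exists>m. ?P m" using ex_sparse_list[OF D, of n "u d" j] unfolding restrict_f by auto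
      then have "?P (F d (restrict f {..<d}) j)" unfolding F_def by (rule LeastI_ex)
      then obtain ys where "sparse_list n (u d) j ys" "ys ! n \<le> F d (restrict f {..<d}) j" "set ys \<subseteq> D"
        unfolding restrict_f by auto
      then show ?thesis using j by (intro exI[of _ ys]) simp
    qed
    then have "{j. g d j > F d (restrict f {..<d}) j} \<subseteq>
        {j. \<exists>ys. sparse_list n (u d) j ys \<and> set ys \<subseteq> D \<and> ys ! n \<le> g d j}" by auto
    moreover have "infinite {j. g d j > F d (restrict f {..<d}) j}"
      using d(1) unfolding le_star_def by simp
    ultimately have "infinite {j. \<exists>ys. sparse_list n (u d) j ys \<and> set ys \<subseteq> D \<and> ys ! n \<le> g d j}"
      using finite_subset by auto
    then show ?thesis using d1(1) d(2,3) by (intro exI[of _ d]) auto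
  qed
  then show ?thesis by (intro exI[of _ g]) simp
qed

section \<open>The almost disjoint family\<close>

text \<open>The interface between the guessing argument and the space. The third clause drives
  compactness for \<open>n\<close>, its exceptional indices \<open>d \<le> b\<close> being countably
  many; the last one drives the failure for \<open>n + 1\<close>.\<close>

definition guess_system :: "nat \<Rightarrow> (omega1 \<Rightarrow> nat list set) \<Rightarrow> bool" where
  "guess_system n A \<longleftrightarrow>
    (\<forall>d c. finite {ys \<in> A d. ys ! 0 \<le> c}) \<and>
    (\<forall>d. \<forall>ys\<in>A d. increasing_list n ys) \<and>
    (\<forall>h. \<exists>b. \<forall>d>b. finite {ys \<in> A d. \<exists>i<n. ys ! Suc i \<le> h (ys ! i)}) \<and>
    (\<forall>b d. b < d \<longrightarrow> finite (A b \<inter> A d)) \<and>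
    (\<forall>D d0. infinite D \<longrightarrow> (\<exists>d>d0. \<forall>m. \<exists>ys\<in>A d. set ys \<subseteq> D \<and> m < ys ! 0))"

text \<open>Almost disjointness comes from closure under \<phi>, where \<open>D (\<phi> b)\<close>
  dominates the bound on last entries of \<open>A b\<close> in terms of first entries. If
  \<open>b < d\<close> and \<open>d\<close> is closed under \<phi>, that function is listed by
  \<open>u d\<close>, so \<open>A d\<close> contains only finitely many lists obeying the
  bound.\<close>

lemma ex_guess_system:
  assumes "diamond_b" and "dominating_number =o cardSuc natLeq"
    and n: "n \<ge> 1"
  shows "\<exists>A. guess_system n A"
proof -
  obtain D :: "omega1 \<Rightarrow> nat \<Rightarrow> nat" where D: "\<And>f. \<exists>b. f \<le>\<^sup>* D b"
    using ex_dominating_omega1[OF assms(2)] by blast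
  \<comment> \<open>As \<open>{..<d}\<close> is countable, \<open>u d\<close> can list all functions
    \<open>D b\<close> with \<open>b < d\<close>.\<close>
  define u where "u d l = D (from_nat_into {..<d} l)" for d l
  have u: "\<exists>l. u d l = D b" if "b < d" for b d
    using from_nat_into_surj[OF countable_lessThan_omega1, of b d] that unfolding u_def by auto
  from diamond_b_guess[OF assms(1), of n u]
  obtain g :: "omega1 \<Rightarrow> nat \<Rightarrow> nat" where g: "\<forall>D \<phi> d0. infinite D \<longrightarrow>
    (\<exists>d>d0. (\<forall>b<d. \<phi> b < d) \<and>
      infinite {j. \<exists>ys. sparse_list n (u d) j ys \<and> set ys \<subseteq> D \<and> ys ! n \<le> g d j})" ..
  have "\<forall>b. \<exists>c. (\<lambda>c. \<Sum>j\<le>c. g b j) \<le>\<^sup>* D c" using D by simp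
  from choice[OF this] obtain \<phi> where \<phi>: "\<And>b. (\<lambda>c. \<Sum>j\<le>c. g b j) \<le>\<^sup>* D (\<phi> b)" by auto
  define A where "A d = (if \<forall>b<d. \<phi> b < d then guess_set n (u d) (g d) else {})" for d
  have A_sub: "A d \<subseteq> guess_set n (u d) (g d)" for d by (simp add: A_def)
  have slow: "finite {ys \<in> A d. \<exists>i<n. ys ! Suc i \<le> h (ys ! i)}" if "b < d" "h \<le>\<^sup>* D b" for h b d
  proof -
    obtain l where "u d l = D b" using u \<open>b < d\<close> by blast
    then have "h \<le>\<^sup>* u d l" using that(2) by simp
    from finite_guess_set_slow[of h "u d" l n "g d", OF this] show ?thesis
      by (rule rev_finite_subset) (use A_sub[of d] in auto)
  qed
  have 1: "finite {ys \<in> A d. ys ! 0 \<le> c}" for d c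
    using finite_guess_set_hd[of n "u d" "g d" c] by (rule rev_finite_subset) (use A_sub[of d] in auto)
  have last: "increasing_list n ys \<and> ys ! n \<le> (\<Sum>j\<le>ys ! 0. g d j)" if "ys \<in> A d" for ys d
    using guess_set_last_le[of ys n "u d" "g d"] that A_sub[of d] by auto
  have 3: "\<exists>b. \<forall>d>b. finite {ys \<in> A d. \<exists>i<n. ys ! Suc i \<le> h (ys ! i)}" for h
    using D[of h] slow by blast
  have 4: "finite (A b \<inter> A d)" if "b < d" for b d
  proof (cases "\<forall>b<d. \<phi> b < d")
    case True
    have "finite {ys \<in> A d. \<exists>i<n. ys ! Suc i \<le> (\<Sum>j\<le>ys ! i. g b j)}"
      using slow[OF _ \<phi>[of b], of d] True that by blast
    then show ?thesis
    proof (rule rev_finite_subset)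
      show "A b \<inter> A d \<subseteq> {ys \<in> A d. \<exists>i<n. ys ! Suc i \<le> (\<Sum>j\<le>ys ! i. g b j)}"
      proof
        fix ys assume ys: "ys \<in> A b \<inter> A d"
        \<comment> \<open>Here \<open>n \<ge> 1\<close> enters: the first jump, at index 0, is
          bounded because the last entry is.\<close>
        then have "ys ! Suc 0 \<le> ys ! n"
          using last[of ys b] increasing_list_nth_mono[of n ys "Suc 0" n] n by simp
        also have "\<dots> \<le> (\<Sum>j\<le>ys ! 0. g b j)" using last[of ys b] ys by simp
        finally show "ys \<in> {ys \<in> A d. \<exists>i<n. ys ! Suc i \<le> (\<Sum>j\<le>ys ! i. g b j)}"
          using ys n by (auto intro!: exI[of _ 0])
      qed
    qed
  next
    case False
    then have "A d = {}" unfolding A_def by (rule if_not_P)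
    then show ?thesis by simp
  qed
  have 5: "\<exists>d>d0. \<forall>m. \<exists>ys\<in>A d. set ys \<subseteq> E \<and> m < ys ! 0" if E: "infinite E" for E d0
  proof -
    obtain d where d: "d0 < d" "\<forall>b<d. \<phi> b < d"
      "infinite {j. \<exists>ys. sparse_list n (u d) j ys \<and> set ys \<subseteq> E \<and> ys ! n \<le> g d j}"
      using g[rule_format, OF E, of d0 \<phi>] by blast
    have "\<exists>ys\<in>A d. set ys \<subseteq> E \<and> m < ys ! 0" for m
    proof -
      obtain j ys where "m < j" "sparse_list n (u d) j ys" "set ys \<subseteq> E" "ys ! n \<le> g d j"
        using d(3) unfolding infinite_nat_iff_unbounded by blast
      then show ?thesis using d(2) by (intro bexI[of _ ys]) (auto simp: A_def guess_set_def sparse_list_def)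
    qed
    then show ?thesis using d(1) by blast
  qed
  have "guess_system n A"
    unfolding guess_system_def using 1 last 3 4 5 by simp
  then show ?thesis by (rule exI[of "guess_system n"])
qed

section \<open>The space of size omega1 and its compactness properties\<close>

theorem theorem38:
  assumes "diamond_b"
    and "dominating_number =o cardSuc natLeq"
  shows "\<forall>n\<ge>1. \<exists>X :: omega1 topology.
           Hausdorff_space X \<and> |topspace X| =o cardSuc natLeq \<and>
           n_sequentially_compact n X \<and> \<not> n_sequentially_compact (n + 1) X"
proof (intro allI impI)
  fix n :: nat
  assume n: "n \<ge> 1"
  from ex_guess_system[OF assms n] obtain A where "guess_system n A" ..
  then have hd: "\<And>d c. finite {ys \<in> A d. ys ! 0 \<le> c}" and
    inc: "\<And>d ys. ys \<in> A d \<Longrightarrow> increasing_list n ys" and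
    slow: "\<And>h. \<exists>b. \<forall>d>b. finite {ys \<in> A d. \<exists>i<n. ys ! Suc i \<le> h (ys ! i)}" and
    ad: "\<And>b d. b < d \<Longrightarrow> finite (A b \<inter> A d)" and
    meets: "\<And>D d0. infinite D \<Longrightarrow> \<exists>d>d0. \<forall>m. \<exists>ys\<in>A d. set ys \<subseteq> D \<and> m < ys ! 0"
    unfolding guess_system_def by simp_all
  \<comment> \<open>The default \<open>0\<close> puts the lists that are not increasing into \<open>S (Inl 0)\<close>.\<close>
  define entry where "entry i ys = (if increasing_list n ys then ys ! i else 0)" for i ys
  have entry_mono: "entry i ys \<le> entry (Suc i) ys" if "i < n" for i ys
    using increasing_list_nth_mono[of n ys i "Suc i"] that by (simp add: entry_def)
  have entry_A: "entry i ys = ys ! i" if "ys \<in> A d" for i ys d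
    using inc[OF that] by (simp add: entry_def)
  \<comment> \<open>The sets \<open>S (Inl c)\<close> cover all lists, so a function that almost
    everywhere avoids each of them has first entries tending to infinity, as
    \<open>growth_bounded\<close> requires.\<close>
  define S where "S b = (case b of Inl c \<Rightarrow> {ys. entry 0 ys = c} | Inr d \<Rightarrow> A d)" for b :: "nat + omega1"
  have S_Inl: "S (Inl c) = {ys. entry 0 ys = c}" and S_Inr: "S (Inr d) = A d" for c d
    by (simp_all add: S_def)
  have finite_hd: "finite ({ys. entry 0 ys = c} \<inter> A d)" for c d
    using hd[of d c] by (rule rev_finite_subset) (auto simp: entry_A)
  have S_ad: "finite (S b \<inter> S b')" if "b \<noteq> b'" for b b'
  proof -
    have "finite (A d \<inter> A d')" if "d \<noteq> d'" for d d'
      using ad[of d d'] ad[of d' d] that by (cases d d' rule: linorder_cases) (auto simp: Int_commute)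
    moreover have "{ys. entry 0 ys = c} \<inter> {ys. entry 0 ys = c'} = {}" if "c \<noteq> c'" for c c'
      using that by auto
    moreover have "finite (A d \<inter> {ys. entry 0 ys = c})" for c d
      using finite_hd[of c d] by (simp add: Int_commute)
    ultimately show ?thesis
      using that finite_hd by (cases b; cases b') (auto simp: S_Inl S_Inr)
  qed

  have "n_sequentially_compact n (mrowka S)"
  proof (rule n_sequentially_compact_mrowka)
    fix B :: "nat set" and f :: "nat set \<Rightarrow> nat list"
    assume B: "infinite B" and avoid: "\<And>a. almost_all_nsets n B (\<lambda>x. f x \<noteq> a)"
    show "\<exists>C\<subseteq>B. infinite C \<and> ((\<exists>b. \<forall>x\<in>nsets C n. f x \<in> S b) \<or>
       (\<forall>b. almost_all_nsets n C (\<lambda>x. f x \<notin> S b)))"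
    proof (cases "\<exists>C\<subseteq>B. infinite C \<and> (\<exists>b. \<forall>x\<in>nsets C n. f x \<in> S b)")
      case False
      \<comment> \<open>Countably many members can be avoided at once; this is applied to the sets
        \<open>S (Inl k)\<close> and, once \<open>b\<close> is known, to the \<open>A d\<close> with
        \<open>d \<le> b\<close>.\<close>
      have avoid_countable: "\<exists>C'\<subseteq>C. infinite C' \<and> (\<forall>k. almost_all_nsets n C' (\<lambda>x. f x \<notin> S (s k)))"
        if C: "C \<subseteq> B" "infinite C" for C and s :: "nat \<Rightarrow> nat + omega1"
      proof -
        obtain C' where C': "C' \<subseteq> C" "infinite C'" "(\<exists>k. \<forall>x\<in>nsets C' n. f x \<in> S (s k)) \<or>
            (\<forall>k. almost_all_nsets n C' (\<lambda>x. f x \<notin> S (s k)))"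
          using homogeneous_or_avoiding[OF C(2), of n "\<lambda>k x. f x \<in> S (s k)"] by auto
        have "\<not> (\<exists>k. \<forall>x\<in>nsets C' n. f x \<in> S (s k))"
          using False C'(1,2) C(1) by (meson subset_trans)
        then show ?thesis using C' by blast
      qed
      obtain C1 where C1: "C1 \<subseteq> B" "infinite C1" "\<forall>k. almost_all_nsets n C1 (\<lambda>x. f x \<notin> S (Inl k))"
        using avoid_countable[OF order_refl B, of Inl] by blast
      have "almost_all_nsets n C1 (\<lambda>x. k < entry 0 (f x))" for k
      proof (rule almost_all_nsets_mono)
        show "almost_all_nsets n C1 (\<lambda>x. \<forall>j\<in>{..k}. f x \<notin> S (Inl j))"
          using C1(3) by (intro almost_all_nsets_Ball) auto
      qed (auto simp: S_Inl not_less[symmetric])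
      then obtain C2 h where C2: "C2 \<subseteq> C1" "infinite C2"
        "\<forall>x\<in>nsets C2 n. \<exists>i<n. entry (Suc i) (f x) \<le> h (entry i (f x))"
        using growth_bounded[OF C1(2), of n "\<lambda>i x. entry i (f x)"] entry_mono by blast
      obtain b where b: "\<forall>d>b. finite {ys \<in> A d. \<exists>i<n. ys ! Suc i \<le> h (ys ! i)}"
        using slow by blast
      have "{..b} = insert b {..<b}" by auto
      then have "countable {..b}" using countable_lessThan_omega1 by simp
      obtain C3 where C3: "C3 \<subseteq> C2" "infinite C3"
        "\<forall>k. almost_all_nsets n C3 (\<lambda>x. f x \<notin> S (Inr (from_nat_into {..b} k)))"
        using avoid_countable[of C2 "\<lambda>k. Inr (from_nat_into {..b} k)"] C2 C1(1) by blast
      have C3B: "C3 \<subseteq> B" and C31: "C3 \<subseteq> C1" using C1 C2 C3 by auto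
      have "almost_all_nsets n C3 (\<lambda>x. f x \<notin> S a)" for a
      proof (cases a)
        case (Inl k)
        then show ?thesis using almost_all_nsets_mono[OF C1(3)[rule_format, of k] C31] by simp
      next
        case (Inr d)
        show ?thesis
        proof (cases "d \<le> b")
          case True
          then obtain k where "from_nat_into {..b} k = d"
            using from_nat_into_surj[OF \<open>countable {..b}\<close>, of d] by auto
          then show ?thesis using C3(3) Inr by auto
        next
          case False
          \<comment> \<open>Values of \<open>f\<close> on \<open>C3\<close> that lie in
            \<open>A d\<close> belong to this finite set, and each single value is avoided almost
            everywhere.\<close>
          let ?T = "{ys \<in> A d. \<exists>i<n. ys ! Suc i \<le> h (ys ! i)}"
          have "finite ?T" using b False by simp
          then have "almost_all_nsets n B (\<lambda>x. \<forall>t\<in>?T. f x \<noteq> t)"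
            using avoid by (rule almost_all_nsets_Ball)
          then show ?thesis
          proof (rule almost_all_nsets_mono[OF _ C3B])
            fix x assume x: "x \<in> nsets C3 n" and T: "\<forall>t\<in>?T. f x \<noteq> t"
            obtain i where "i < n" "entry (Suc i) (f x) \<le> h (entry i (f x))"
              using C2(3) in_nsets_mono[OF x C3(1)] by blast
            then have "f x \<in> ?T" if "f x \<in> A d" using that entry_A[OF that] by auto
            then show "f x \<notin> S a" using T Inr by (auto simp: S_Inr)
          qed
        qed
      qed
      then show ?thesis using C3(2) C3B by blast
    qed blast
  qed
  moreover have "\<not> n_sequentially_compact (n + 1) (mrowka S)"
  proof -
    \<comment> \<open>The function without convergent restriction is the identity on (n+1)-sets,
      each set being replaced by its increasing enumeration.\<close>
    have meets': "\<exists>d>d0. \<not> almost_all_nsets (n + 1) B (\<lambda>x. sorted_list_of_set x \<notin> A d)"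
      if B: "infinite B" for B d0
    proof -
      obtain d where d: "d > d0" "\<And>m. \<exists>ys\<in>A d. set ys \<subseteq> B \<and> m < ys ! 0"
        using meets[OF B, of d0] by blast
      have "\<exists>x\<in>nsets (B \<inter> {m<..}) (n + 1). sorted_list_of_set x \<in> A d" for m
      proof -
        obtain ys where ys: "ys \<in> A d" "set ys \<subseteq> B" "m < ys ! 0" using d(2) by blast
        note i = inc[OF ys(1)]
        then have len: "length ys = Suc n" and sorted: "sorted_wrt (<) ys"
          by (auto simp: increasing_list_def)
        have "m < y" if "y \<in> set ys" for y
        proof -
          obtain k where "k < length ys" "y = ys ! k" using \<open>y \<in> set ys\<close> by (auto simp: in_set_conv_nth)
          then show ?thesis using increasing_list_nth_mono[OF i, of 0 k] len ys(3) by simp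
        qed
        moreover have "card (set ys) = n + 1"
          using len sorted by (simp add: distinct_card strict_sorted_iff)
        ultimately have "set ys \<in> nsets (B \<inter> {m<..}) (n + 1)"
          using ys(2) by (auto simp: nsets_def)
        moreover have "sorted_list_of_set (set ys) = ys"
          using sorted by (simp add: strict_sorted_iff sorted_list_of_set.idem_if_sorted_distinct)
        ultimately show ?thesis using ys(1) by (intro bexI[of _ "set ys"]) simp_all
      qed
      then show ?thesis using d(1) unfolding almost_all_nsets_def by blast
    qed
    \<comment> \<open>A list enumerates only one set, and a nonempty set does not lie beyond its own
      maximum.\<close>
    have avoid: "almost_all_nsets (n + 1) B (\<lambda>x. sorted_list_of_set x \<noteq> t)" for t B
      unfolding almost_all_nsets_def
    proof (intro exI ballI notI)
      fix x assume x: "x \<in> nsets (B \<inter> {Max (set t)<..}) (n + 1)" and t: "sorted_list_of_set x = t"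
      then have x: "finite x" "x \<noteq> {}" "x \<subseteq> {Max (set t)<..}" by (auto simp: nsets_def)
      have "set t = x" unfolding t[symmetric] using x(1) by simp
      then have "Max (set t) \<in> {Max (set t)<..}" using Max_in[OF x(1,2)] x(3) by auto
      then show False by simp
    qed
    show ?thesis
    proof (rule not_n_sequentially_compact_mrowka[OF _ _ _ S_ad])
      fix B :: "nat set" assume B: "infinite B"
      show "\<exists>b. \<not> almost_all_nsets (n + 1) B (\<lambda>x. sorted_list_of_set x \<notin> S b)"
        using meets'[OF B] S_Inr by metis
      show "\<not> almost_all_nsets (n + 1) B (\<lambda>x. sorted_list_of_set x = a)" for a
      proof
        assume "almost_all_nsets (n + 1) B (\<lambda>x. sorted_list_of_set x = a)"
        from almost_all_nsets_conj[OF this avoid[of B a]]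
        have "almost_all_nsets (n + 1) B (\<lambda>x. sorted_list_of_set x \<notin> A d)" for d
          by (rule almost_all_nsets_mono) auto
        then show False using meets'[OF B] by blast
      qed
      show "\<not> almost_all_nsets (n + 1) B (\<lambda>x. sorted_list_of_set x \<in> S b)" for b
      proof
        assume b: "almost_all_nsets (n + 1) B (\<lambda>x. sorted_list_of_set x \<in> S b)"
        \<comment> \<open>The aim is \<open>Inr d \<noteq> b\<close>. If \<open>b\<close> is of the
          form \<open>Inl _\<close>, every \<open>d\<close> qualifies and the bound
          \<open>undefined\<close> is arbitrary.\<close>
        obtain d where d: "d > (case b of Inl _ \<Rightarrow> undefined | Inr d0 \<Rightarrow> d0)"
          "\<not> almost_all_nsets (n + 1) B (\<lambda>x. sorted_list_of_set x \<notin> A d)"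
          using meets'[OF B] by blast
        have "b \<noteq> Inr d" using d(1) by auto
        then have "finite (S b \<inter> A d)" using S_ad[of b "Inr d"] by (simp add: S_Inr)
        then have "almost_all_nsets (n + 1) B (\<lambda>x. \<forall>t\<in>S b \<inter> A d. sorted_list_of_set x \<noteq> t)"
          using avoid by (rule almost_all_nsets_Ball)
        from almost_all_nsets_conj[OF b this]
        have "almost_all_nsets (n + 1) B (\<lambda>x. sorted_list_of_set x \<notin> A d)"
          by (rule almost_all_nsets_mono) auto
        then show False using d(2) by blast
      qed
    qed
  qed
  moreover obtain e :: "omega1 \<Rightarrow> nat list + (nat + omega1) option" where "bij e"
    using ex_bij_omega1 by blast
  moreover have "Hausdorff_space (mrowka S)" using S_ad by (rule Hausdorff_mrowka)
  ultimately obtain X :: "omega1 topology" where "Hausdorff_space X" "topspace X = UNIV"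
      "n_sequentially_compact n X" "\<not> n_sequentially_compact (n + 1) X"
    using bijection_topology_transfer[of e "mrowka S"] topspace_mrowka[of S] by auto
  then show "\<exists>X :: omega1 topology.
           Hausdorff_space X \<and> |topspace X| =o cardSuc natLeq \<and>
           n_sequentially_compact n X \<and> \<not> n_sequentially_compact (n + 1) X"
    using card_of_omega1 by (intro exI[of _ X]) simp
qed

end
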